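(* Let $m\in\mathbb{N}$ and $P\subseteq H_m$. Then $P$ is piecewise syndetic if and only if there are a minimal right ideal $Y\subseteq\varprojlim\beta H_n=S(G)$ and some $\alpha\in Y$ with $P\in\alpha(m)$. Equivalently, $P$ is piecewise syndetic if and only if $\tilde{P}:=\{\alpha\in S(G):P\in\alpha(m)\}$ meets some minimal right ideal of $S(G)$.
   Context: Let $L$ be a relational language and $\mathbf{K}$ a Fraïssé structure, i.e. a countably infinite $L$-structure that is ultrahomogeneous (every isomorphism between finite substructures of $\mathbf{K}$ extends to an automorphism of $\mathbf{K}$). Let $G=\mathrm{Aut}(\mathbf{K})$. Fix an exhaustion $\mathbf{K}=\bigcup_n\mathbf{A}_n$ by finite substructures with $\mathbf{A}_m\subseteq\mathbf{A}_n$ for $m\le n$. $\mathrm{Emb}(\mathbf{A},\mathbf{B})$ is the set of embeddings of $\mathbf{A}$ into $\mathbf{B}$, and $H_n=\mathrm{Emb}(\mathbf{A}_n,\mathbf{K})$. $G$ acts on the right on $2^{H_m}$ (product topology) by $(\chi_A\cdot g)(f)=\chi_A(g\circ f)$ for $A\subseteq H_m$, $g\in G$, $f\in H_m$. A set $S\subseteq H_m$ is syndetic if $\chi_\emptyset\notin\overline{\chi_S\cdot G}$; $P\subseteq H_m$ is piecewise syndetic if there is a syndetic $S\subseteq H_m$ with $\chi_S\in\overline{\chi_P\cdot G}$. $\beta H_n$ is the compact space of ultrafilters on the discrete set $H_n$. For $m\le n$, the restriction map $H_n\to H_m$, $x\mapsto x|_{\mathbf{A}_m}$, extends to a continuous map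 $\tilde{\imath}^n_m:\beta H_n\to\beta H_m$. $S(G)=\varprojlim\beta H_n$ is the inverse limit along the maps $\tilde{\imath}^n_m$; for $\alpha\in S(G)$, $\alpha(m)\in\beta H_m$ is its $m$-th coordinate. For $\alpha\in S(G)$ and $f\in H_m$, let $\alpha\cdot f\in\beta H_m$ be given by: $S\in\alpha\cdot f$ iff $\{x\in H_n: x\circ f\in S\}\in\alpha(n)$, where $n\ge m$ is large enough that $\mathrm{ran}(f)\subseteq\mathbf{A}_n$ (independent of such $n$). $S(G)$ is a compact left-topological semigroup with multiplication: for $S\subseteq H_m$, $S\in(\alpha\gamma)(m)$ iff $\{f\in H_m: S\in\alpha\cdot f\}\in\gamma(m)$. A right ideal is a nonempty $R\subseteq S(G)$ with $R\,S(G)\subseteq R$; a minimal right ideal is one containing no properly smaller right ideal. *)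

theory Defs
  imports "HOL-Analysis.Analysis"
begin

section \<open>Relational structures and embeddings\<close>

record 'r language =
  syms :: "'r set"
  arity :: "'r \<Rightarrow> nat"

record ('r, 'a) rel_struct =
  universe :: "'a set"
  interp :: "'r \<Rightarrow> 'a list set"

definition is_rel_struct :: "'r language \<Rightarrow> ('r, 'a) rel_struct \<Rightarrow> bool" where
  "is_rel_struct L M \<longleftrightarrow>
     (\<forall>r\<in>syms L. interp M r \<subseteq> {xs. length xs = arity L r \<and> set xs \<subseteq> universe M})"

definition substructure :: "'r language \<Rightarrow> ('r, 'a) rel_struct \<Rightarrow> ('r, 'a) rel_struct \<Rightarrow> bool" where
  "substructure L B M \<longleftrightarrow>
     is_rel_struct L B \<and> is_rel_struct L M \<and> universe B \<subseteq> universe M \<and>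
     (\<forall>r\<in>syms L. interp B r = {xs \<in> interp M r. set xs \<subseteq> universe B})"

text \<open>Maps between structures are extensional (\<open>undefined\<close> outside the domain), so that
  distinct members of \<open>Emb\<close> are distinct as maps; composition and restriction are accordingly
  \<^const>\<open>compose\<close> and \<^const>\<open>restrict\<close>.\<close>

definition Emb :: "'r language \<Rightarrow> ('r, 'a) rel_struct \<Rightarrow> ('r, 'b) rel_struct \<Rightarrow> ('a \<Rightarrow> 'b) set" where
  "Emb L B C = {f \<in> universe B \<rightarrow>\<^sub>E universe C. inj_on f (universe B) \<and>
     (\<forall>r\<in>syms L. \<forall>xs. length xs = arity L r \<and> set xs \<subseteq> universe B \<longrightarrow>
        (xs \<in> interp B r \<longleftrightarrow> map f xs \<in> interp C r))}"

definition Iso :: "'r language \<Rightarrow> ('r, 'a) rel_struct \<Rightarrow> ('r, 'b) rel_struct \<Rightarrow> ('a \<Rightarrow> 'b) set" where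
  "Iso L B C = {f \<in> Emb L B C. f ` universe B = universe C}"

definition Aut :: "'r language \<Rightarrow> ('r, 'a) rel_struct \<Rightarrow> ('a \<Rightarrow> 'a) set" where
  "Aut L K = Iso L K K"

definition ultrahomogeneous :: "'r language \<Rightarrow> ('r, 'a) rel_struct \<Rightarrow> bool" where
  "ultrahomogeneous L K \<longleftrightarrow>
     (\<forall>B C f. substructure L B K \<and> finite (universe B) \<and> substructure L C K \<and> finite (universe C) \<and>
        f \<in> Iso L B C \<longrightarrow> (\<exists>g\<in>Aut L K. \<forall>x\<in>universe B. g x = f x))"

definition fraisse_structure :: "'r language \<Rightarrow> ('r, 'a) rel_struct \<Rightarrow> bool" where
  "fraisse_structure L K \<longleftrightarrow>
     is_rel_struct L K \<and> countable (universe K) \<and> infinite (universe K) \<and> ultrahomogeneous L K"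

definition exhaustion ::
  "'r language \<Rightarrow> ('r, 'a) rel_struct \<Rightarrow> (nat \<Rightarrow> ('r, 'a) rel_struct) \<Rightarrow> bool" where
  "exhaustion L K A \<longleftrightarrow>
     (\<forall>n. substructure L (A n) K \<and> finite (universe (A n))) \<and>
     (\<forall>m n. m \<le> n \<longrightarrow> substructure L (A m) (A n)) \<and>
     (\<Union>n. universe (A n)) = universe K"

definition H_set ::
  "'r language \<Rightarrow> ('r, 'a) rel_struct \<Rightarrow> (nat \<Rightarrow> ('r, 'a) rel_struct) \<Rightarrow> nat \<Rightarrow> ('a \<Rightarrow> 'a) set" where
  "H_set L K A n = Emb L (A n) K"


section \<open>Syndetic and piecewise syndetic sets\<close>

text \<open>In this section \<open>B\<close> is a finite substructure of \<open>K\<close>; the points of \<open>2^Emb(B,K)\<close> are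
  extensional predicates.\<close>

definition cantor_space ::
  "'r language \<Rightarrow> ('r, 'a) rel_struct \<Rightarrow> ('r, 'a) rel_struct \<Rightarrow> (('a \<Rightarrow> 'a) \<Rightarrow> bool) topology" where
  "cantor_space L K B = product_topology (\<lambda>_. discrete_topology UNIV) (Emb L B K)"

definition char_fn ::
  "'r language \<Rightarrow> ('r, 'a) rel_struct \<Rightarrow> ('r, 'a) rel_struct \<Rightarrow> ('a \<Rightarrow> 'a) set \<Rightarrow> ('a \<Rightarrow> 'a) \<Rightarrow> bool" where
  "char_fn L K B S = (\<lambda>f\<in>Emb L B K. f \<in> S)"

definition shift ::
  "'r language \<Rightarrow> ('r, 'a) rel_struct \<Rightarrow> ('r, 'a) rel_struct \<Rightarrow>
     (('a \<Rightarrow> 'a) \<Rightarrow> bool) \<Rightarrow> ('a \<Rightarrow> 'a) \<Rightarrow> ('a \<Rightarrow> 'a) \<Rightarrow> bool" where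
  "shift L K B \<phi> g = (\<lambda>f\<in>Emb L B K. \<phi> (compose (universe B) g f))"

definition orbit_closure ::
  "'r language \<Rightarrow> ('r, 'a) rel_struct \<Rightarrow> ('r, 'a) rel_struct \<Rightarrow>
     (('a \<Rightarrow> 'a) \<Rightarrow> bool) \<Rightarrow> (('a \<Rightarrow> 'a) \<Rightarrow> bool) set" where
  "orbit_closure L K B \<phi> = cantor_space L K B closure_of (shift L K B \<phi> ` Aut L K)"

definition syndetic ::
  "'r language \<Rightarrow> ('r, 'a) rel_struct \<Rightarrow> ('r, 'a) rel_struct \<Rightarrow> ('a \<Rightarrow> 'a) set \<Rightarrow> bool" where
  "syndetic L K B S \<longleftrightarrow>
     S \<subseteq> Emb L B K \<and> char_fn L K B {} \<notin> orbit_closure L K B (char_fn L K B S)"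

definition piecewise_syndetic ::
  "'r language \<Rightarrow> ('r, 'a) rel_struct \<Rightarrow> ('r, 'a) rel_struct \<Rightarrow> ('a \<Rightarrow> 'a) set \<Rightarrow> bool" where
  "piecewise_syndetic L K B P \<longleftrightarrow>
     P \<subseteq> Emb L B K \<and>
     (\<exists>S. syndetic L K B S \<and> char_fn L K B S \<in> orbit_closure L K B (char_fn L K B P))"


section \<open>Spaces of ultrafilters\<close>

definition ultrafilters :: "'x set \<Rightarrow> 'x set set set" where
  "ultrafilters X = {U. U \<subseteq> Pow X \<and> X \<in> U \<and> {} \<notin> U \<and>
     (\<forall>S\<in>U. \<forall>T\<in>U. S \<inter> T \<in> U) \<and>
     (\<forall>S\<in>U. \<forall>T. S \<subseteq> T \<and> T \<subseteq> X \<longrightarrow> T \<in> U) \<and>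
     (\<forall>S. S \<subseteq> X \<longrightarrow> S \<in> U \<or> X - S \<in> U)}"

definition beta_space :: "'x set \<Rightarrow> 'x set set topology" where
  "beta_space X = topology_generated_by {{U \<in> ultrafilters X. S \<in> U} | S. S \<subseteq> X}"

definition principal_uf :: "'x set \<Rightarrow> 'x \<Rightarrow> 'x set set" where
  "principal_uf X x = {S. S \<subseteq> X \<and> x \<in> S}"

text \<open>The continuous extension to ultrafilters of a map \<open>r\<close> from \<open>X\<close> to \<open>Y\<close> is the push-forward;
  \<open>beta_map_continuous\<close>, \<open>beta_map_principal\<close> and \<open>beta_map_unique\<close> below
  characterise it as the unique continuous extension.\<close>

definition beta_map :: "'x set \<Rightarrow> 'y set \<Rightarrow> ('x \<Rightarrow> 'y) \<Rightarrow> 'x set set \<Rightarrow> 'y set set" where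
  "beta_map X Y r U = {S. S \<subseteq> Y \<and> {x \<in> X. r x \<in> S} \<in> U}"

lemma ultrafilters_inter: "U \<in> ultrafilters X \<Longrightarrow> S \<in> U \<Longrightarrow> T \<in> U \<Longrightarrow> S \<inter> T \<in> U"
  by (simp add: ultrafilters_def)

lemma ultrafilters_mono:
  "U \<in> ultrafilters X \<Longrightarrow> S \<in> U \<Longrightarrow> S \<subseteq> T \<Longrightarrow> T \<subseteq> X \<Longrightarrow> T \<in> U"
  unfolding ultrafilters_def mem_Collect_eq by metis

lemma ultrafilters_top: "U \<in> ultrafilters X \<Longrightarrow> X \<in> U"
  by (simp add: ultrafilters_def)

lemma ultrafilters_empty: "U \<in> ultrafilters X \<Longrightarrow> {} \<notin> U"
  by (simp add: ultrafilters_def)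

lemma ultrafilters_sub: "U \<in> ultrafilters X \<Longrightarrow> S \<in> U \<Longrightarrow> S \<subseteq> X"
  unfolding ultrafilters_def mem_Collect_eq by (metis PowD subsetD)

lemma ultrafilters_compl:
  assumes "U \<in> ultrafilters X" "S \<subseteq> X"
  shows "X - S \<in> U \<longleftrightarrow> S \<notin> U"
proof -
  have "S \<in> U \<or> X - S \<in> U" using assms by (simp add: ultrafilters_def)
  moreover have "\<not> (S \<in> U \<and> X - S \<in> U)"
    using ultrafilters_inter[OF assms(1), of S "X - S"] ultrafilters_empty[OF assms(1)] by auto
  ultimately show ?thesis by blast
qed

lemma topspace_beta_space: "topspace (beta_space X) = ultrafilters X"
  unfolding beta_space_def topology_generated_by_topspace
  by (auto dest: ultrafilters_top)

lemma principal_uf_in: "x \<in> X \<Longrightarrow> principal_uf X x \<in> ultrafilters X"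
  unfolding principal_uf_def ultrafilters_def by auto

lemma beta_map_in:
  assumes r: "r \<in> X \<rightarrow> Y" and U: "U \<in> ultrafilters X"
  shows "beta_map X Y r U \<in> ultrafilters Y"
proof -
  have 1: "{x \<in> X. r x \<in> Y} = X" using r by auto
  have 2: "{x \<in> X. r x \<in> S \<inter> T} = {x \<in> X. r x \<in> S} \<inter> {x \<in> X. r x \<in> T}" for S T by auto
  have 3: "{x \<in> X. r x \<in> Y - S} = X - {x \<in> X. r x \<in> S}" for S using r by auto
  have 4: "T \<in> beta_map X Y r U" if "S \<in> beta_map X Y r U" "S \<subseteq> T" "T \<subseteq> Y" for S T
    using that ultrafilters_mono[OF U, of "{x \<in> X. r x \<in> S}" "{x \<in> X. r x \<in> T}"]
    unfolding beta_map_def by auto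
  have 5: "S \<inter> T \<in> beta_map X Y r U" if "S \<in> beta_map X Y r U" "T \<in> beta_map X Y r U" for S T
    using that ultrafilters_inter[OF U] unfolding beta_map_def mem_Collect_eq 2 by auto
  have 6: "S \<in> beta_map X Y r U \<or> Y - S \<in> beta_map X Y r U" if "S \<subseteq> Y" for S
    using that ultrafilters_compl[OF U, of "{x \<in> X. r x \<in> S}"]
    unfolding beta_map_def mem_Collect_eq 3 by auto
  have 7: "Y \<in> beta_map X Y r U" "{} \<notin> beta_map X Y r U" "beta_map X Y r U \<subseteq> Pow Y"
    using ultrafilters_top[OF U] ultrafilters_empty[OF U] unfolding beta_map_def
    by (auto simp: 1)
  show ?thesis
    unfolding ultrafilters_def mem_Collect_eq using 4 5 6 7 by (intro conjI ballI allI impI) simp_all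
qed

lemma beta_map_principal:
  "r \<in> X \<rightarrow> Y \<Longrightarrow> x \<in> X \<Longrightarrow> beta_map X Y r (principal_uf X x) = principal_uf Y (r x)"
  unfolding beta_map_def principal_uf_def by auto

lemma beta_map_continuous:
  assumes r: "r \<in> X \<rightarrow> Y"
  shows "continuous_map (beta_space X) (beta_space Y) (beta_map X Y r)"
  unfolding beta_space_def[of Y]
proof (rule continuous_on_generated_topo)
  fix W assume "W \<in> {{U \<in> ultrafilters Y. S \<in> U} | S. S \<subseteq> Y}"
  then obtain S where S: "S \<subseteq> Y" "W = {U \<in> ultrafilters Y. S \<in> U}" by auto
  have "beta_map X Y r -` W \<inter> topspace (beta_space X)
      = {U \<in> ultrafilters X. {x \<in> X. r x \<in> S} \<in> U}"
    using S beta_map_in[OF r] by (auto simp: topspace_beta_space beta_map_def)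
  then show "openin (beta_space X) (beta_map X Y r -` W \<inter> topspace (beta_space X))"
    unfolding beta_space_def by (auto intro!: topology_generated_by_Basis)
next
  have "beta_map X Y r ` ultrafilters X \<subseteq> {U \<in> ultrafilters Y. Y \<in> U}"
    using beta_map_in[OF r] ultrafilters_top by fast
  also have "\<dots> \<subseteq> \<Union> {{U \<in> ultrafilters Y. S \<in> U} | S. S \<subseteq> Y}"
    by (rule Union_upper) auto
  finally show "beta_map X Y r ` topspace (beta_space X) \<subseteq> \<Union> {{U \<in> ultrafilters Y. S \<in> U} | S. S \<subseteq> Y}"
    unfolding topspace_beta_space .
qed

lemma openin_beta_space_basis:
  assumes W: "openin (beta_space X) W" and UW: "U \<in> W" and U: "U \<in> ultrafilters X"
  shows "\<exists>T\<in>U. \<forall>V\<in>ultrafilters X. T \<in> V \<longrightarrow> V \<in> W"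
proof -
  have "generate_topology_on {{U \<in> ultrafilters X. S \<in> U} | S. S \<subseteq> X} W"
    using W unfolding beta_space_def openin_topology_generated_by_iff .
  then show ?thesis using UW
  proof induction
    case Empty
    then show ?case by simp
  next
    case (Int a b)
    obtain S where S: "S \<in> U" "\<And>V. V \<in> ultrafilters X \<Longrightarrow> S \<in> V \<Longrightarrow> V \<in> a"
      using Int by auto
    obtain T where T: "T \<in> U" "\<And>V. V \<in> ultrafilters X \<Longrightarrow> T \<in> V \<Longrightarrow> V \<in> b"
      using Int by auto
    have "V \<in> a \<inter> b" if V: "V \<in> ultrafilters X" "S \<inter> T \<in> V" for V
    proof -
      have "S \<in> V" "T \<in> V"
        using ultrafilters_mono[OF V, of S] ultrafilters_mono[OF V, of T]
          ultrafilters_sub[OF U S(1)] ultrafilters_sub[OF U T(1)] by simp_all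
      then show ?thesis using S(2) T(2) V(1) by simp
    qed
    moreover have "S \<inter> T \<in> U" using ultrafilters_inter[OF U S(1) T(1)] .
    ultimately show ?case by (intro bexI[of _ "S \<inter> T"]) simp_all
  next
    case (UN Q)
    then obtain k where k: "k \<in> Q" "U \<in> k" by auto
    then obtain T where "T \<in> U" "\<forall>V\<in>ultrafilters X. T \<in> V \<longrightarrow> V \<in> k" using UN.IH by auto
    then show ?case using k(1) by (intro bexI[of _ T]) auto
  next
    case (Basis s)
    then obtain S where "s = {U \<in> ultrafilters X. S \<in> U}" by auto
    then show ?case using Basis(2) by (intro bexI[of _ S]) auto
  qed
qed

lemma beta_map_unique:
  assumes r: "r \<in> X \<rightarrow> Y" and g: "continuous_map (beta_space X) (beta_space Y) g"
    and ext: "\<And>x. x \<in> X \<Longrightarrow> g (principal_uf X x) = principal_uf Y (r x)"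
    and U: "U \<in> ultrafilters X"
  shows "g U = beta_map X Y r U"
proof -
  have gU: "g U \<in> ultrafilters Y"
    using g U unfolding continuous_map_def topspace_beta_space by auto
  have sub: "S \<in> beta_map X Y r U" if S: "S \<in> g U" for S
  proof -
    have SY: "S \<subseteq> Y" using ultrafilters_sub[OF gU S] .
    have "openin (beta_space Y) {V \<in> ultrafilters Y. S \<in> V}"
      unfolding beta_space_def using SY by (auto intro: topology_generated_by_Basis)
    then have "openin (beta_space X) {V \<in> ultrafilters X. g V \<in> {V \<in> ultrafilters Y. S \<in> V}}"
      using openin_continuous_map_preimage[OF g] by (metis topspace_beta_space)
    from openin_beta_space_basis[OF this, of U] U gU S
    obtain T where T: "T \<in> U" "\<forall>V\<in>ultrafilters X. T \<in> V \<longrightarrow> S \<in> g V" by auto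
    have TX: "T \<subseteq> X" using ultrafilters_sub[OF U T(1)] .
    have "T \<subseteq> {x \<in> X. r x \<in> S}"
    proof
      fix x assume x: "x \<in> T"
      then have xX: "x \<in> X" and "T \<in> principal_uf X x"
        using TX by (auto simp: principal_uf_def)
      then have "S \<in> g (principal_uf X x)"
        using T(2) principal_uf_in[OF xX] by blast
      then show "x \<in> {x \<in> X. r x \<in> S}" using ext xX by (simp add: principal_uf_def)
    qed
    then show ?thesis using ultrafilters_mono[OF U T(1)] SY by (auto simp: beta_map_def)
  qed
  have "S \<in> g U" if "S \<in> beta_map X Y r U" for S
  proof (rule ccontr)
    assume n: "S \<notin> g U"
    have SY: "S \<subseteq> Y" using that by (auto simp: beta_map_def)
    then have "Y - S \<in> beta_map X Y r U" using sub ultrafilters_compl[OF gU SY] n by blast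
    then show False using ultrafilters_compl[OF beta_map_in[OF r U] SY] that by blast
  qed
  then show ?thesis using sub by blast
qed


section \<open>The semigroup \<open>S(G)\<close> and its right ideals\<close>

definition restr_map ::
  "'r language \<Rightarrow> ('r, 'a) rel_struct \<Rightarrow> (nat \<Rightarrow> ('r, 'a) rel_struct) \<Rightarrow> nat \<Rightarrow> nat \<Rightarrow>
     ('a \<Rightarrow> 'a) set set \<Rightarrow> ('a \<Rightarrow> 'a) set set" where
  "restr_map L K A n m =
     beta_map (H_set L K A n) (H_set L K A m) (\<lambda>x. restrict x (universe (A m)))"

definition SG ::
  "'r language \<Rightarrow> ('r, 'a) rel_struct \<Rightarrow> (nat \<Rightarrow> ('r, 'a) rel_struct) \<Rightarrow>
     (nat \<Rightarrow> ('a \<Rightarrow> 'a) set set) set" where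
  "SG L K A = {\<alpha>. (\<forall>n. \<alpha> n \<in> ultrafilters (H_set L K A n)) \<and>
     (\<forall>m n. m \<le> n \<longrightarrow> restr_map L K A n m (\<alpha> n) = \<alpha> m)}"

text \<open>\<open>sg_act L K A \<alpha> m f\<close> is \<open>\<alpha> \<cdot> f\<close> for \<open>f\<close> in \<open>H m\<close>. It is computed at the least admissible level;
  by \<open>sg_act_eq\<close> below every admissible level gives the same result.\<close>

definition sg_act ::
  "'r language \<Rightarrow> ('r, 'a) rel_struct \<Rightarrow> (nat \<Rightarrow> ('r, 'a) rel_struct) \<Rightarrow>
     (nat \<Rightarrow> ('a \<Rightarrow> 'a) set set) \<Rightarrow> nat \<Rightarrow> ('a \<Rightarrow> 'a) \<Rightarrow> ('a \<Rightarrow> 'a) set set" where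
  "sg_act L K A \<alpha> m f =
     (let n = (LEAST n. m \<le> n \<and> f ` universe (A m) \<subseteq> universe (A n))
      in {S. S \<subseteq> H_set L K A m \<and>
             {x \<in> H_set L K A n. compose (universe (A m)) x f \<in> S} \<in> \<alpha> n})"

definition sg_mult ::
  "'r language \<Rightarrow> ('r, 'a) rel_struct \<Rightarrow> (nat \<Rightarrow> ('r, 'a) rel_struct) \<Rightarrow>
     (nat \<Rightarrow> ('a \<Rightarrow> 'a) set set) \<Rightarrow> (nat \<Rightarrow> ('a \<Rightarrow> 'a) set set) \<Rightarrow> nat \<Rightarrow> ('a \<Rightarrow> 'a) set set" where
  "sg_mult L K A \<alpha> \<gamma> = (\<lambda>m. {S. S \<subseteq> H_set L K A m \<and>
     {f \<in> H_set L K A m. S \<in> sg_act L K A \<alpha> m f} \<in> \<gamma> m})"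

definition right_ideal ::
  "'r language \<Rightarrow> ('r, 'a) rel_struct \<Rightarrow> (nat \<Rightarrow> ('r, 'a) rel_struct) \<Rightarrow>
     (nat \<Rightarrow> ('a \<Rightarrow> 'a) set set) set \<Rightarrow> bool" where
  "right_ideal L K A R \<longleftrightarrow>
     R \<noteq> {} \<and> R \<subseteq> SG L K A \<and> (\<forall>\<alpha>\<in>R. \<forall>\<gamma>\<in>SG L K A. sg_mult L K A \<alpha> \<gamma> \<in> R)"

definition minimal_right_ideal ::
  "'r language \<Rightarrow> ('r, 'a) rel_struct \<Rightarrow> (nat \<Rightarrow> ('r, 'a) rel_struct) \<Rightarrow>
     (nat \<Rightarrow> ('a \<Rightarrow> 'a) set set) set \<Rightarrow> bool" where
  "minimal_right_ideal L K A Y \<longleftrightarrow>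
     right_ideal L K A Y \<and> (\<forall>R. right_ideal L K A R \<and> R \<subseteq> Y \<longrightarrow> R = Y)"

definition tilde_set ::
  "'r language \<Rightarrow> ('r, 'a) rel_struct \<Rightarrow> (nat \<Rightarrow> ('r, 'a) rel_struct) \<Rightarrow> nat \<Rightarrow>
     ('a \<Rightarrow> 'a) set \<Rightarrow> (nat \<Rightarrow> ('a \<Rightarrow> 'a) set set) set" where
  "tilde_set L K A m P = {\<alpha> \<in> SG L K A. P \<in> \<alpha> m}"

lemma restrict_in_Emb:
  assumes "substructure L B C" "x \<in> Emb L C K"
  shows "restrict x (universe B) \<in> Emb L B K"
proof -
  have sub: "universe B \<subseteq> universe C" using assms(1) by (simp add: substructure_def)
  have x: "x \<in> universe C \<rightarrow>\<^sub>E universe K" "inj_on x (universe C)"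
    "\<And>r xs. r \<in> syms L \<Longrightarrow> length xs = arity L r \<Longrightarrow> set xs \<subseteq> universe C \<Longrightarrow>
        xs \<in> interp C r \<longleftrightarrow> map x xs \<in> interp K r"
    using assms(2) by (auto simp: Emb_def)
  have "restrict x (universe B) \<in> universe B \<rightarrow>\<^sub>E universe K"
    using x(1) sub by (simp add: PiE_iff subset_iff)
  moreover have "inj_on (restrict x (universe B)) (universe B)"
    using inj_on_subset[OF x(2) sub] by (simp add: inj_on_def)
  moreover have "xs \<in> interp B r \<longleftrightarrow> map (restrict x (universe B)) xs \<in> interp K r"
    if "r \<in> syms L" "length xs = arity L r" "set xs \<subseteq> universe B" for r xs
  proof -
    have m: "map (restrict x (universe B)) xs = map x xs" using that(3) by auto
    have "xs \<in> interp B r \<longleftrightarrow> xs \<in> interp C r"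
      using assms(1) that by (simp add: substructure_def)
    then show ?thesis unfolding m using x(3)[OF that(1,2)] that(3) sub by blast
  qed
  ultimately show ?thesis by (simp add: Emb_def)
qed

lemma sg_act_eq:
  fixes K :: "('r, 'a) rel_struct"
  assumes A: "exhaustion L K A" and \<alpha>: "\<alpha> \<in> SG L K A"
    and n: "m \<le> n" "f ` universe (A m) \<subseteq> universe (A n)"
  shows "sg_act L K A \<alpha> m f = {S. S \<subseteq> H_set L K A m \<and>
             {x \<in> H_set L K A n. compose (universe (A m)) x f \<in> S} \<in> \<alpha> n}"
proof -
  define k where "k = (LEAST n. m \<le> n \<and> f ` universe (A m) \<subseteq> universe (A n))"
  have k: "m \<le> k" "f ` universe (A m) \<subseteq> universe (A k)" "k \<le> n"
    unfolding k_def using LeastI[of "\<lambda>n. m \<le> n \<and> f ` universe (A m) \<subseteq> universe (A n)" n] n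
    by (auto intro: Least_le)
  have eq: "restr_map L K A n k (\<alpha> n) = \<alpha> k" using \<alpha> k(3) by (auto simp: SG_def)
  have c: "compose (universe (A m)) (restrict x (universe (A k))) f = compose (universe (A m)) x f"
    for x :: "'a \<Rightarrow> 'a"
    using k(2) by (auto simp: compose_def restrict_def fun_eq_iff)
  have r: "restrict x (universe (A k)) \<in> H_set L K A k" if "x \<in> H_set L K A n" for x
  proof -
    have "substructure L (A k) (A n)" using A k(3) by (simp add: exhaustion_def)
    then show ?thesis using restrict_in_Emb that unfolding H_set_def by metis
  qed
  have "{x \<in> H_set L K A k. compose (universe (A m)) x f \<in> S} \<in> \<alpha> k \<longleftrightarrow>
        {x \<in> H_set L K A n. compose (universe (A m)) x f \<in> S} \<in> \<alpha> n" for S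
  proof -
    let ?T = "{x \<in> H_set L K A k. compose (universe (A m)) x f \<in> S}"
    have "?T \<in> \<alpha> k \<longleftrightarrow> ?T \<in> restr_map L K A n k (\<alpha> n)"
      by (simp only: eq)
    also have "\<dots> \<longleftrightarrow> {x \<in> H_set L K A n. restrict x (universe (A k)) \<in> ?T} \<in> \<alpha> n"
      unfolding restr_map_def beta_map_def by simp
    also have "{x \<in> H_set L K A n. restrict x (universe (A k)) \<in> ?T}
        = {x \<in> H_set L K A n. compose (universe (A m)) x f \<in> S}"
      using r by (simp add: c cong: conj_cong)
    finally show ?thesis .
  qed
  then show ?thesis unfolding sg_act_def k_def[symmetric] Let_def by simp
qed

end

theory Submission
  imports Defs
begin

text \<open>
  For \<open>\<alpha>\<close> in \<open>S(G)\<close> and \<open>S \<subseteq> H\<^sub>m\<close> let \<open>\<alpha>\<inverse>S = {f \<in> H\<^sub>m. S \<in> \<alpha> \<cdot> f}\<close>; this is \<open>preimage\<close> below. Everything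
  happens in terms of these preimages, for three reasons.

  \<^item> The orbit closure of \<open>\<chi>\<^sub>S\<close> consists of the characteristic functions of the sets \<open>\<alpha>\<inverse>S\<close>
    (\<open>in_orbit_closure_char_fn_iff\<close>). By ultrahomogeneity every embedding of \<open>A\<^sub>n\<close> extends to an
    automorphism, so \<open>G\<close> is dense in \<open>S(G)\<close> (\<open>Aut_dense\<close>); hence \<open>\<chi>\<^bsub>\<alpha>\<inverse>S\<^esub>\<close> is a limit of shifts of
    \<open>\<chi>\<^sub>S\<close>. Conversely a limit of shifts gives finitely satisfiable conditions on \<open>\<alpha>\<close>, and \<open>S(G)\<close>
    is compact (\<open>Semi_compact\<close>).
  \<^item> \<open>(\<alpha>\<gamma>)\<inverse>S = \<gamma>\<inverse>(\<alpha>\<inverse>S)\<close> (\<open>preimage_mult\<close>).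
  \<^item> \<open>S \<in> \<alpha>(m)\<close> exactly if the inclusion of \<open>A\<^sub>m\<close> lies in \<open>\<alpha>\<inverse>S\<close>, and \<open>S \<in> (\<alpha>\<gamma>)(m)\<close> exactly if
    \<open>\<alpha>\<inverse>S \<in> \<gamma>(m)\<close>.

  So \<open>P\<close> is piecewise syndetic if and only if there is an \<open>\<alpha>\<close> such that \<open>(\<alpha>\<gamma>)\<inverse>P\<close> is nonempty for
  every \<open>\<gamma>\<close>, that is, \<open>\<beta>\<inverse>P \<noteq> \<emptyset>\<close> for every \<open>\<beta>\<close> in the right ideal \<open>\<alpha> S(G)\<close>.

  Given such an \<open>\<alpha>\<close>, take a minimal right ideal \<open>Y \<subseteq> \<alpha> S(G)\<close>, a \<open>\<beta> \<in> Y\<close> and an \<open>f \<in> \<beta>\<inverse>P\<close>. An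
  automorphism \<open>g\<close> extending \<open>f\<close>, viewed as a point of \<open>S(G)\<close>, satisfies \<open>\<beta>\<inverse>P \<in> g(m)\<close>, so
  \<open>\<beta>g \<in> Y\<close> has \<open>P \<in> (\<beta>g)(m)\<close>. Conversely let \<open>\<alpha>\<close> lie in a minimal right ideal \<open>Y\<close> with
  \<open>P \<in> \<alpha>(m)\<close>. For every \<open>\<gamma>\<close> minimality gives a \<open>\<delta>\<close> with \<open>\<alpha>\<gamma>\<delta> = \<alpha>\<close>, and
  \<open>\<delta>\<inverse>((\<alpha>\<gamma>)\<inverse>P) = \<alpha>\<inverse>P\<close> contains the inclusion of \<open>A\<^sub>m\<close>, so \<open>(\<alpha>\<gamma>)\<inverse>P\<close> is nonempty.

  That every right ideal contains a minimal one follows from Zorn's lemma, because the ideals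
  \<open>\<alpha> S(G)\<close> are closed (\<open>principal_ideal_closed\<close>) and \<open>S(G)\<close> is compact. No topology on \<open>S(G)\<close> is
  introduced: a closed set is described by the basic conditions \<open>T \<in> \<alpha>(n)\<close> that hold on it, given
  as pairs \<open>(n, T)\<close>, and compactness says that finitely satisfiable families of conditions are
  satisfiable.
\<close>

section \<open>Extending families of sets to ultrafilters\<close>

text \<open>By Zorn's lemma, a family with the finite intersection property relative to \<open>X\<close> lies in a
  maximal one; maximality forces the maximal family to decide every subset of \<open>X\<close>.\<close>

lemma ultrafilter_extension:
  assumes B: "\<B> \<subseteq> Pow X"
    and fip: "\<And>F. finite F \<Longrightarrow> F \<subseteq> \<B> \<Longrightarrow> X \<inter> \<Inter>F \<noteq> {}"
  shows "\<exists>U\<in>ultrafilters X. \<B> \<subseteq> U"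
proof -
  define fip_families where
    "fip_families = {\<C>. \<B> \<subseteq> \<C> \<and> \<C> \<subseteq> Pow X \<and> (\<forall>F. finite F \<and> F \<subseteq> \<C> \<longrightarrow> X \<inter> \<Inter>F \<noteq> {})}"
  have "\<exists>M\<in>fip_families. \<forall>\<C>\<in>fip_families. M \<subseteq> \<C> \<longrightarrow> \<C> = M"
  proof (rule subset_Zorn_nonempty)
    have "\<B> \<in> fip_families"
      unfolding fip_families_def using B fip by simp
    then show "fip_families \<noteq> {}" by blast
  next
    fix \<D> assume ne: "\<D> \<noteq> {}" and chain: "subset.chain fip_families \<D>"
    have mem: "\<B> \<subseteq> \<C>" "\<C> \<subseteq> Pow X"
      "\<And>F. finite F \<Longrightarrow> F \<subseteq> \<C> \<Longrightarrow> X \<inter> \<Inter>F \<noteq> {}" if "\<C> \<in> \<D>" for \<C>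
    proof -
      have "\<C> \<in> fip_families"
        using chain that unfolding subset.chain_def by (elim conjE) (rule subsetD)
      then show "\<B> \<subseteq> \<C>" "\<C> \<subseteq> Pow X"
        "\<And>F. finite F \<Longrightarrow> F \<subseteq> \<C> \<Longrightarrow> X \<inter> \<Inter>F \<noteq> {}"
        by (simp_all add: fip_families_def)
    qed
    have "X \<inter> \<Inter>F \<noteq> {}" if F: "finite F" "F \<subseteq> \<Union>\<D>" for F
    proof -
      obtain \<C> where "\<C> \<in> \<D>" "F \<subseteq> \<C>"
        using finite_subset_Union_chain[OF F ne chain] .
      then show ?thesis using mem(3) F(1) by simp
    qed
    moreover have "\<B> \<subseteq> \<Union>\<D>" using ne mem(1) by fast
    moreover have "\<Union>\<D> \<subseteq> Pow X" using mem(2) by (rule Union_least)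
    ultimately show "\<Union>\<D> \<in> fip_families"
      by (simp add: fip_families_def)
  qed
  then obtain M where M: "M \<in> fip_families"
    and max: "\<And>\<C>. \<C> \<in> fip_families \<Longrightarrow> M \<subseteq> \<C> \<Longrightarrow> \<C> = M" by blast
  have BM: "\<B> \<subseteq> M" and MX: "M \<subseteq> Pow X"
    and fipM: "\<And>F. finite F \<Longrightarrow> F \<subseteq> M \<Longrightarrow> X \<inter> \<Inter>F \<noteq> {}"
    using M by (simp_all add: fip_families_def)
  have M_insert: "S \<in> M"
    if S: "S \<subseteq> X" and G: "\<And>G. finite G \<Longrightarrow> G \<subseteq> M \<Longrightarrow> X \<inter> S \<inter> \<Inter>G \<noteq> {}" for S
  proof -
    have "X \<inter> \<Inter>F \<noteq> {}" if F: "finite F" "F \<subseteq> insert S M" for F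
    proof -
      have "X \<inter> S \<inter> \<Inter>(F - {S}) \<noteq> {}" by (rule G) (use F in auto)
      then show ?thesis by blast
    qed
    moreover have "\<B> \<subseteq> insert S M" "insert S M \<subseteq> Pow X" using BM MX S by simp_all blast
    ultimately have "insert S M \<in> fip_families"
      unfolding fip_families_def by (intro CollectI conjI allI impI) simp_all
    then have "insert S M = M" by (rule max) (rule subset_insertI)
    then show ?thesis by blast
  qed
  have M_filter: "S \<in> M" if S: "S \<subseteq> X" and F: "finite F" "F \<subseteq> M" "X \<inter> \<Inter>F \<subseteq> S" for S F
  proof (rule M_insert[OF S])
    fix G assume "finite G" "G \<subseteq> M"
    then have "X \<inter> \<Inter>(F \<union> G) \<noteq> {}" using F(1,2) by (intro fipM) simp_all
    then show "X \<inter> S \<inter> \<Inter>G \<noteq> {}" using F(3) by auto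
  qed
  have "X \<in> M" using M_filter[of X "{}"] by simp
  moreover have "{} \<notin> M" using fipM[of "{{}}"] by auto
  moreover have "S \<inter> T \<in> M" if "S \<in> M" "T \<in> M" for S T
    using M_filter[of "S \<inter> T" "{S, T}"] that MX by auto
  moreover have "T \<in> M" if "S \<in> M" "S \<subseteq> T" "T \<subseteq> X" for S T
    using M_filter[of T "{S}"] that by auto
  moreover have "S \<in> M \<or> X - S \<in> M" if S: "S \<subseteq> X" for S
  proof (rule disjCI)
    assume "X - S \<notin> M"
    then have not_sub: "\<not> X \<inter> \<Inter>G \<subseteq> X - S" if "finite G" "G \<subseteq> M" for G
      using M_filter[OF Diff_subset that] by blast
    show "S \<in> M"
    proof (rule M_insert[OF S])
      fix G assume "finite G" "G \<subseteq> M"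
      from not_sub[OF this] show "X \<inter> S \<inter> \<Inter>G \<noteq> {}" by blast
    qed
  qed
  ultimately have "M \<in> ultrafilters X"
    using MX unfolding ultrafilters_def by simp
  then show ?thesis using BM by blast
qed


section \<open>Embeddings and automorphisms\<close>

lemma compose_in_Emb:
  assumes f: "f \<in> Emb L B C" and g: "g \<in> Emb L C D"
  shows "compose (universe B) g f \<in> Emb L B D"
proof -
  have fB: "f \<in> universe B \<rightarrow> universe C" and gC: "g \<in> universe C \<rightarrow> universe D"
    and injf: "inj_on f (universe B)" and injg: "inj_on g (universe C)"
    using f g by (auto simp: Emb_def)
  have "inj_on (compose (universe B) g f) (universe B)"
    using injf injg fB by (auto simp: inj_on_def compose_eq Pi_def)
  moreover have "xs \<in> interp B r \<longleftrightarrow> map (compose (universe B) g f) xs \<in> interp D r"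
    if r: "r \<in> syms L" and xs: "length xs = arity L r" "set xs \<subseteq> universe B" for r xs
  proof -
    have m: "map (compose (universe B) g f) xs = map g (map f xs)"
      using xs(2) by (auto simp: compose_eq)
    have "set (map f xs) \<subseteq> universe C" using fB xs(2) by auto
    then have "map f xs \<in> interp C r \<longleftrightarrow> map g (map f xs) \<in> interp D r"
      using g r xs(1) unfolding Emb_def by simp
    moreover have "xs \<in> interp B r \<longleftrightarrow> map f xs \<in> interp C r"
      using f r xs unfolding Emb_def by simp
    ultimately show ?thesis unfolding m by blast
  qed
  ultimately show ?thesis
    using funcset_compose[OF fB gC] by (simp add: Emb_def PiE_def)
qed

lemma substructure_inclusion_in_Emb:
  assumes "substructure L B C"
  shows "(\<lambda>x\<in>universe B. x) \<in> Emb L B C"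
proof -
  have "map (\<lambda>x\<in>universe B. x) xs = xs" if "set xs \<subseteq> universe B" for xs
    using that by (induction xs) auto
  then show ?thesis
    using assms by (auto simp: Emb_def substructure_def inj_on_def subset_iff)
qed

lemma Emb_corestrict:
  assumes f: "f \<in> Emb L B K" and C: "substructure L C K" and ran: "f ` universe B \<subseteq> universe C"
  shows "f \<in> Emb L B C"
proof -
  have "map f xs \<in> interp K r \<longleftrightarrow> map f xs \<in> interp C r"
    if "r \<in> syms L" "set xs \<subseteq> universe B" for r xs
    using C that ran unfolding substructure_def by auto
  then show ?thesis
    using f ran unfolding Emb_def by (auto simp: PiE_iff)
qed

text \<open>Ultrahomogeneity speaks of isomorphisms between finite substructures; an embedding is an
  isomorphism onto the substructure that its image induces.\<close>

lemma embedding_extends_to_automorphism: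
  assumes K: "ultrahomogeneous L K" and B: "substructure L B K" "finite (universe B)"
    and x: "x \<in> Emb L B K"
  shows "\<exists>g\<in>Aut L K. restrict g (universe B) = x"
proof -
  define C where "C = \<lparr>universe = x ` universe B,
    interp = \<lambda>r. {xs \<in> interp K r. set xs \<subseteq> x ` universe B}\<rparr>"
  have ran: "x ` universe B \<subseteq> universe K" using x by (auto simp: Emb_def)
  have C: "substructure L C K"
    using B(1) ran unfolding substructure_def is_rel_struct_def C_def by auto
  have "x \<in> Emb L B C" using Emb_corestrict[OF x C] by (simp add: C_def)
  then have "x \<in> Iso L B C" by (simp add: Iso_def C_def)
  moreover have "finite (universe C)" using B(2) by (simp add: C_def)
  ultimately obtain g where g: "g \<in> Aut L K" "\<forall>a\<in>universe B. g a = x a"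
    using K B C unfolding ultrahomogeneous_def by blast
  have "x \<in> extensional (universe B)" using x by (auto simp: Emb_def PiE_def)
  then have "restrict g (universe B) = x"
    using g(2) by (auto simp: fun_eq_iff extensional_def)
  then show ?thesis using g(1) by blast
qed

text \<open>The product topology is that of pointwise convergence, so a limit of shifts is a function that
  agrees with some shift on any given finite set of embeddings.\<close>

lemma in_orbit_closure_iff:
  assumes "\<phi> \<in> extensional (Emb L B K)"
  shows "\<phi> \<in> orbit_closure L K B \<psi> \<longleftrightarrow>
    (\<forall>F. finite F \<and> F \<subseteq> Emb L B K \<longrightarrow> (\<exists>g\<in>Aut L K. \<forall>f\<in>F. shift L K B \<psi> g f = \<phi> f))"
    (is "_ \<longleftrightarrow> ?approx")
proof
  assume cl: "\<phi> \<in> orbit_closure L K B \<psi>"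
  show ?approx
  proof (intro allI impI, elim conjE)
    fix F assume F: "finite F" "F \<subseteq> Emb L B K"
    define W where "W = (\<Pi>\<^sub>E f\<in>Emb L B K. if f \<in> F then {\<phi> f} else UNIV)"
    have "openin (cantor_space L K B) W"
      unfolding cantor_space_def W_def
      by (rule openin_PiE_gen[THEN iffD2])
        (auto intro!: disjI2 finite_subset[OF _ F(1)] split: if_splits)
    moreover have "\<phi> \<in> W" using assms by (auto simp: W_def PiE_iff)
    ultimately obtain \<psi>' where \<psi>': "\<psi>' \<in> shift L K B \<psi> ` Aut L K" "\<psi>' \<in> W"
      using cl unfolding orbit_closure_def in_closure_of by blast
    then obtain g where "g \<in> Aut L K" "\<psi>' = shift L K B \<psi> g" by blast
    moreover have "\<psi>' f = \<phi> f" if "f \<in> F" for f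
      using \<psi>'(2) that F(2) unfolding W_def by (auto dest!: PiE_mem[of _ _ _ f])
    ultimately show "\<exists>g\<in>Aut L K. \<forall>f\<in>F. shift L K B \<psi> g f = \<phi> f" by blast
  qed
next
  assume approx: ?approx
  show "\<phi> \<in> orbit_closure L K B \<psi>"
    unfolding orbit_closure_def in_closure_of
  proof (intro conjI allI impI)
    show "\<phi> \<in> topspace (cantor_space L K B)"
      using assms by (simp add: cantor_space_def PiE_iff)
  next
    fix W assume "\<phi> \<in> W \<and> openin (cantor_space L K B) W"
    then obtain Y where Y: "finite {f \<in> Emb L B K. Y f \<noteq> UNIV}"
      "\<phi> \<in> Pi\<^sub>E (Emb L B K) Y" "Pi\<^sub>E (Emb L B K) Y \<subseteq> W"
      unfolding cantor_space_def openin_product_topology_alt by force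
    then obtain g where g: "g \<in> Aut L K"
      "\<forall>f\<in>{f \<in> Emb L B K. Y f \<noteq> UNIV}. shift L K B \<psi> g f = \<phi> f"
      using approx[THEN spec, of "{f \<in> Emb L B K. Y f \<noteq> UNIV}"] by (auto simp del: mem_Collect_eq)
    have "shift L K B \<psi> g \<in> Pi\<^sub>E (Emb L B K) Y"
    proof (rule PiE_I)
      fix f assume "f \<in> Emb L B K"
      then show "shift L K B \<psi> g f \<in> Y f"
        using g(2) Y(2) by (cases "Y f = UNIV") (auto dest: PiE_mem)
    qed (simp add: shift_def)
    then show "\<exists>y. y \<in> shift L K B \<psi> ` Aut L K \<and> y \<in> W" using Y(3) g(1) by blast
  qed
qed


section \<open>Preimages of sets under points of \<open>S(G)\<close>\<close>

locale exhausted_fraisse_structure =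
  fixes L :: "'r language" and K :: "('r, 'a) rel_struct" and A :: "nat \<Rightarrow> ('r, 'a) rel_struct"
  assumes fraisse: "fraisse_structure L K" and exhaustion: "exhaustion L K A"
begin

abbreviation "U n \<equiv> universe (A n)"
abbreviation "H n \<equiv> H_set L K A n"
abbreviation "Semi \<equiv> SG L K A"
abbreviation mult (infixl "\<odot>" 70) where "\<alpha> \<odot> \<gamma> \<equiv> sg_mult L K A \<alpha> \<gamma>"
abbreviation "incl m \<equiv> (\<lambda>x\<in>U m. x)"

text \<open>For \<open>\<alpha>\<close> given by an automorphism \<open>g\<close> and \<open>S \<subseteq> H\<^sub>m\<close> this is \<open>{f \<in> H\<^sub>m. g \<circ> f \<in> S}\<close>, the preimage of
  \<open>S\<close> under left multiplication by \<open>g\<close>; it is written \<open>\<alpha>\<inverse>S\<close> in the explanations.\<close>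

definition preimage where
  "preimage \<alpha> m S = {f \<in> H m. S \<in> sg_act L K A \<alpha> m f}"

lemma substructure_K: "substructure L (A n) K"
  and finite_U: "finite (U n)"
  and substructure_mono: "m \<le> n \<Longrightarrow> substructure L (A m) (A n)"
  using exhaustion by (auto simp: exhaustion_def)

lemma U_mono: "m \<le> n \<Longrightarrow> U m \<subseteq> U n"
  using substructure_mono by (simp add: substructure_def)

lemma incl_in_H: "incl m \<in> H m"
  unfolding H_set_def by (rule substructure_inclusion_in_Emb[OF substructure_K])

lemma compose_in_H:
  assumes f: "f \<in> H m" "f ` U m \<subseteq> U n" and x: "x \<in> H n"
  shows "compose (U m) x f \<in> H m"
  using compose_in_Emb[OF Emb_corestrict[OF _ substructure_K f(2)]] f(1) x
  by (simp add: H_set_def)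

lemma compose_incl: "compose (U m) x (incl m) = restrict x (U m)"
  by (auto simp: compose_def fun_eq_iff)

lemma finite_subset_level:
  assumes "finite F" "F \<subseteq> universe K"
  obtains n where "m \<le> n" "F \<subseteq> U n"
proof -
  have "\<exists>n\<ge>m. F \<subseteq> U n" using assms
  proof (induction F)
    case empty
    then show ?case by auto
  next
    case (insert a F)
    then obtain n where n: "n \<ge> m" "F \<subseteq> U n" by auto
    have "a \<in> (\<Union>n. U n)" using insert.prems exhaustion by (simp add: exhaustion_def)
    then obtain k where "a \<in> U k" by blast
    then show ?case
      using n U_mono[of n "max n k"] U_mono[of k "max n k"]
      by (intro exI[of _ "max n k"]) auto
  qed
  then show thesis using that by blast
qed

lemma H_level:
  assumes "f \<in> H m"
  obtains n where "m \<le> n" "f ` U m \<subseteq> U n"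
proof -
  have "finite (f ` U m)" "f ` U m \<subseteq> universe K"
    using assms finite_U by (auto simp: H_set_def Emb_def)
  from finite_subset_level[OF this] show thesis using that by blast
qed

lemma Semi_ultrafilter: "\<alpha> \<in> Semi \<Longrightarrow> \<alpha> n \<in> ultrafilters (H n)"
  by (simp add: SG_def)

lemma Semi_restrict:
  assumes "\<alpha> \<in> Semi" "m \<le> n" "S \<subseteq> H m"
  shows "{x \<in> H n. restrict x (U m) \<in> S} \<in> \<alpha> n \<longleftrightarrow> S \<in> \<alpha> m"
proof -
  have "\<alpha> m = restr_map L K A n m (\<alpha> n)" using assms by (simp add: SG_def)
  then show ?thesis using assms(3) by (simp add: restr_map_def beta_map_def)
qed

text \<open>One inclusion suffices because ultrafilters are maximal among proper filters.\<close>

lemma Semi_eqI: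
  assumes "\<alpha> \<in> Semi" "\<beta> \<in> Semi" and le: "\<And>n T. T \<in> \<alpha> n \<Longrightarrow> T \<in> \<beta> n"
  shows "\<alpha> = \<beta>"
proof (intro ext set_eqI iffI)
  fix n T assume T: "T \<in> \<beta> n"
  note \<alpha> = Semi_ultrafilter[OF assms(1), of n] and \<beta> = Semi_ultrafilter[OF assms(2), of n]
  have "T \<subseteq> H n" using ultrafilters_sub[OF \<beta> T] .
  then show "T \<in> \<alpha> n"
    using ultrafilters_compl[OF \<alpha>] ultrafilters_compl[OF \<beta>] T le by blast
qed (rule le)

lemma sg_act_level:
  assumes "\<alpha> \<in> Semi" "m \<le> n" "f ` U m \<subseteq> U n"
  shows "sg_act L K A \<alpha> m f = beta_map (H n) (H m) (\<lambda>x. compose (U m) x f) (\<alpha> n)"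
  unfolding sg_act_eq[OF exhaustion assms] beta_map_def ..

lemma sg_act_ultrafilter:
  assumes \<alpha>: "\<alpha> \<in> Semi" and f: "f \<in> H m"
  shows "sg_act L K A \<alpha> m f \<in> ultrafilters (H m)"
proof -
  obtain n where n: "m \<le> n" "f ` U m \<subseteq> U n" using H_level[OF f] .
  show ?thesis
    unfolding sg_act_level[OF \<alpha> n]
    by (rule beta_map_in[OF _ Semi_ultrafilter[OF \<alpha>]]) (auto intro: compose_in_H[OF f n(2)])
qed

lemma preimage_level:
  assumes "\<alpha> \<in> Semi" "m \<le> n" "f \<in> H m" "f ` U m \<subseteq> U n" "S \<subseteq> H m"
  shows "f \<in> preimage \<alpha> m S \<longleftrightarrow> {x \<in> H n. compose (U m) x f \<in> S} \<in> \<alpha> n"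
  using assms by (simp add: preimage_def sg_act_level beta_map_def)

lemma preimage_subset: "preimage \<alpha> m S \<subseteq> H m"
  by (auto simp: preimage_def)

lemma preimage_H: "\<alpha> \<in> Semi \<Longrightarrow> preimage \<alpha> m (H m) = H m"
  using ultrafilters_top[OF sg_act_ultrafilter] by (auto simp: preimage_def)

lemma preimage_empty: "\<alpha> \<in> Semi \<Longrightarrow> preimage \<alpha> m {} = {}"
  using ultrafilters_empty[OF sg_act_ultrafilter] by (auto simp: preimage_def)

lemma preimage_Int:
  "\<alpha> \<in> Semi \<Longrightarrow> preimage \<alpha> m S \<inter> preimage \<alpha> m T \<subseteq> preimage \<alpha> m (S \<inter> T)"
  using ultrafilters_inter[OF sg_act_ultrafilter] by (auto simp: preimage_def)

lemma preimage_mono: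
  "\<alpha> \<in> Semi \<Longrightarrow> S \<subseteq> T \<Longrightarrow> T \<subseteq> H m \<Longrightarrow> preimage \<alpha> m S \<subseteq> preimage \<alpha> m T"
  using ultrafilters_mono[OF sg_act_ultrafilter] by (auto simp: preimage_def)

lemma preimage_compl:
  "\<alpha> \<in> Semi \<Longrightarrow> S \<subseteq> H m \<Longrightarrow> preimage \<alpha> m (H m - S) = H m - preimage \<alpha> m S"
  using ultrafilters_compl[OF sg_act_ultrafilter] by (auto simp: preimage_def)

lemma incl_in_preimage_iff:
  assumes "\<alpha> \<in> Semi" "S \<subseteq> H m"
  shows "incl m \<in> preimage \<alpha> m S \<longleftrightarrow> S \<in> \<alpha> m"
  using preimage_level[OF assms(1) le_refl incl_in_H _ assms(2)] Semi_restrict[OF assms(1) le_refl assms(2)]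
  by (simp add: compose_incl)

text \<open>Precomposition with \<open>f\<close> commutes with taking preimages: both sides say that \<open>(z \<circ> y) \<circ> f \<in> S\<close>
  for \<open>\<alpha>\<close>-almost all \<open>z\<close>. With \<open>f\<close> the inclusion of \<open>A\<^sub>m\<close> this makes the coordinates of a product
  compatible under restriction; with general \<open>f\<close> it gives the rule for preimages under a product.\<close>

lemma preimage_compose:
  assumes \<alpha>: "\<alpha> \<in> Semi" and mn: "m \<le> n" and f: "f \<in> H m" "f ` U m \<subseteq> U n" and S: "S \<subseteq> H m"
  shows "preimage \<alpha> n {x \<in> H n. compose (U m) x f \<in> S}
    = {y \<in> H n. compose (U m) y f \<in> preimage \<alpha> m S}"
proof -
  have "y \<in> preimage \<alpha> n {x \<in> H n. compose (U m) x f \<in> S}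
      \<longleftrightarrow> compose (U m) y f \<in> preimage \<alpha> m S" if y: "y \<in> H n" for y
  proof -
    obtain k where k: "n \<le> k" "y ` U n \<subseteq> U k" using H_level[OF y] .
    have yf: "compose (U m) y f ` U m \<subseteq> U k"
      using k(2) f(2) by (auto simp: compose_eq)
    have mk: "m \<le> k" using mn k(1) by simp
    have assoc: "compose (U m) (compose (U n) z y) f = compose (U m) z (compose (U m) y f)" for z
      using f(2) by (auto simp: compose_def fun_eq_iff)
    have "y \<in> preimage \<alpha> n {x \<in> H n. compose (U m) x f \<in> S} \<longleftrightarrow>
        {z \<in> H k. compose (U n) z y \<in> {x \<in> H n. compose (U m) x f \<in> S}} \<in> \<alpha> k"
      by (rule preimage_level[OF \<alpha> k(1) y k(2)]) auto
    \<comment> \<open>Composites of \<open>z\<close> with \<open>y\<close> automatically lie in \<open>H n\<close>.\<close>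
    also have "{z \<in> H k. compose (U n) z y \<in> {x \<in> H n. compose (U m) x f \<in> S}} =
        {z \<in> H k. compose (U m) z (compose (U m) y f) \<in> S}"
      using compose_in_H[OF y k(2)] by (auto simp: assoc)
    also have "\<dots> \<in> \<alpha> k \<longleftrightarrow> compose (U m) y f \<in> preimage \<alpha> m S"
      using preimage_level[OF \<alpha> mk compose_in_H[OF f y] yf S] by simp
    finally show ?thesis .
  qed
  then show ?thesis
    using preimage_subset[of \<alpha> n "{x \<in> H n. compose (U m) x f \<in> S}"] by blast
qed

lemma preimage_restrict:
  assumes \<alpha>: "\<alpha> \<in> Semi" and mn: "m \<le> n" and S: "S \<subseteq> H m"
  shows "preimage \<alpha> n {x \<in> H n. restrict x (U m) \<in> S}
    = {y \<in> H n. restrict y (U m) \<in> preimage \<alpha> m S}"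
  using preimage_compose[OF \<alpha> mn incl_in_H _ S] U_mono[OF mn] by (simp add: compose_incl)

lemma in_mult_iff: "T \<in> (\<alpha> \<odot> \<gamma>) n \<longleftrightarrow> T \<subseteq> H n \<and> preimage \<alpha> n T \<in> \<gamma> n"
  by (simp add: sg_mult_def preimage_def)

text \<open>Taking preimages under \<open>\<alpha>\<close> preserves the Boolean operations and restriction, so it pulls the
  coherent family of ultrafilters \<open>\<gamma>\<close> back to another one.\<close>

lemma mult_in_Semi:
  assumes \<alpha>: "\<alpha> \<in> Semi" and \<gamma>: "\<gamma> \<in> Semi"
  shows "\<alpha> \<odot> \<gamma> \<in> Semi"
proof -
  have "(\<alpha> \<odot> \<gamma>) n \<in> ultrafilters (H n)" for n
  proof -
    note u = Semi_ultrafilter[OF \<gamma>, of n]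
    have "H n \<in> (\<alpha> \<odot> \<gamma>) n" "{} \<notin> (\<alpha> \<odot> \<gamma>) n"
      using ultrafilters_top[OF u] ultrafilters_empty[OF u]
      by (simp_all add: in_mult_iff preimage_H preimage_empty \<alpha>)
    moreover have "S \<inter> T \<in> (\<alpha> \<odot> \<gamma>) n" if "S \<in> (\<alpha> \<odot> \<gamma>) n" "T \<in> (\<alpha> \<odot> \<gamma>) n" for S T
      using that ultrafilters_mono[OF u ultrafilters_inter[OF u] preimage_Int[OF \<alpha>] preimage_subset]
      by (auto simp: in_mult_iff)
    moreover have "T \<in> (\<alpha> \<odot> \<gamma>) n" if "S \<in> (\<alpha> \<odot> \<gamma>) n" "S \<subseteq> T" "T \<subseteq> H n" for S T
      using that ultrafilters_mono[OF u _ preimage_mono[OF \<alpha>] preimage_subset]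
      by (auto simp: in_mult_iff)
    moreover have "S \<in> (\<alpha> \<odot> \<gamma>) n \<or> H n - S \<in> (\<alpha> \<odot> \<gamma>) n" if "S \<subseteq> H n" for S
      using that ultrafilters_compl[OF u preimage_subset]
      by (simp add: in_mult_iff preimage_compl[OF \<alpha>])
    moreover have "(\<alpha> \<odot> \<gamma>) n \<subseteq> Pow (H n)" by (auto simp: in_mult_iff)
    ultimately show ?thesis unfolding ultrafilters_def by blast
  qed
  moreover have "restr_map L K A n m ((\<alpha> \<odot> \<gamma>) n) = (\<alpha> \<odot> \<gamma>) m" if mn: "m \<le> n" for m n
    using Semi_restrict[OF \<gamma> mn preimage_subset]
    by (auto simp: restr_map_def beta_map_def in_mult_iff preimage_restrict[OF \<alpha> mn])
  ultimately show ?thesis by (simp add: SG_def)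
qed

lemma preimage_mult:
  assumes \<alpha>: "\<alpha> \<in> Semi" and \<gamma>: "\<gamma> \<in> Semi" and S: "S \<subseteq> H m"
  shows "preimage (\<alpha> \<odot> \<gamma>) m S = preimage \<gamma> m (preimage \<alpha> m S)"
proof -
  have "f \<in> preimage (\<alpha> \<odot> \<gamma>) m S \<longleftrightarrow> f \<in> preimage \<gamma> m (preimage \<alpha> m S)" if f: "f \<in> H m" for f
  proof -
    obtain n where n: "m \<le> n" "f ` U m \<subseteq> U n" using H_level[OF f] .
    have "f \<in> preimage (\<alpha> \<odot> \<gamma>) m S \<longleftrightarrow> {x \<in> H n. compose (U m) x f \<in> S} \<in> (\<alpha> \<odot> \<gamma>) n"
      by (rule preimage_level[OF mult_in_Semi[OF \<alpha> \<gamma>] n(1) f n(2) S])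
    also have "\<dots> \<longleftrightarrow> {y \<in> H n. compose (U m) y f \<in> preimage \<alpha> m S} \<in> \<gamma> n"
      by (auto simp: in_mult_iff preimage_compose[OF \<alpha> n(1) f n(2) S])
    also have "\<dots> \<longleftrightarrow> f \<in> preimage \<gamma> m (preimage \<alpha> m S)"
      by (rule preimage_level[OF \<gamma> n(1) f n(2) preimage_subset, symmetric])
    finally show ?thesis .
  qed
  then show ?thesis using preimage_subset by blast
qed

lemma mult_assoc:
  assumes "\<alpha> \<in> Semi" "\<gamma> \<in> Semi" "\<delta> \<in> Semi"
  shows "(\<alpha> \<odot> \<gamma>) \<odot> \<delta> = \<alpha> \<odot> (\<gamma> \<odot> \<delta>)"
  using preimage_subset
  by (auto simp: fun_eq_iff set_eq_iff in_mult_iff preimage_mult[OF assms(1,2)])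


section \<open>Density of the automorphism group and compactness of \<open>S(G)\<close>\<close>

text \<open>The canonical map from \<open>G\<close> into \<open>S(G)\<close>.\<close>

definition of_aut where
  "of_aut g n = principal_uf (H n) (restrict g (U n))"

lemma restrict_aut_in_H: "g \<in> Aut L K \<Longrightarrow> restrict g (U n) \<in> H n"
  using restrict_in_Emb[OF substructure_K] by (auto simp: Aut_def Iso_def H_set_def)

lemma in_of_aut_iff: "T \<in> of_aut g n \<longleftrightarrow> T \<subseteq> H n \<and> restrict g (U n) \<in> T"
  by (simp add: of_aut_def principal_uf_def)

lemma U_Int_U: "m \<le> n \<Longrightarrow> U n \<inter> U m = U m"
  using U_mono by (rule Int_absorb1)

text \<open>The extension of \<open>of_aut\<close> to ultrafilters on \<open>G\<close>. It is how points of \<open>S(G)\<close> are produced in the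
  compactness argument.\<close>

lemma ultrafilter_on_Aut_gives_Semi:
  assumes W: "W \<in> ultrafilters (Aut L K)"
  shows "(\<lambda>n. beta_map (Aut L K) (H n) (\<lambda>g. restrict g (U n)) W) \<in> Semi" (is "?\<alpha> \<in> _")
proof -
  have "?\<alpha> n \<in> ultrafilters (H n)" for n
    by (rule beta_map_in[OF _ W]) (simp add: restrict_aut_in_H)
  moreover have "restr_map L K A n m (?\<alpha> n) = ?\<alpha> m" if mn: "m \<le> n" for m n
    using restrict_aut_in_H
    by (auto simp: restr_map_def beta_map_def U_Int_U[OF mn] cong: conj_cong)
  ultimately show ?thesis by (simp add: SG_def)
qed

lemma of_aut_in_Semi:
  assumes "g \<in> Aut L K"
  shows "of_aut g \<in> Semi"
proof -
  have "of_aut g = (\<lambda>n. beta_map (Aut L K) (H n) (\<lambda>g. restrict g (U n)) (principal_uf (Aut L K) g))"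
    using assms by (simp add: of_aut_def fun_eq_iff beta_map_principal restrict_aut_in_H)
  then show ?thesis
    using ultrafilter_on_Aut_gives_Semi[OF principal_uf_in[OF assms]] by simp
qed

lemma extend_to_aut:
  assumes "x \<in> H n"
  shows "\<exists>g\<in>Aut L K. restrict g (U n) = x"
proof -
  have "ultrahomogeneous L K" using fraisse by (simp add: fraisse_structure_def)
  from embedding_extends_to_automorphism[OF this substructure_K finite_U] assms
  show ?thesis by (simp add: H_set_def)
qed

text \<open>Conditions at different levels can be pulled back to the largest of these levels and intersected
  there, so every neighbourhood of \<open>\<alpha>\<close> contains one given by a single condition.\<close>

lemma finitely_many_conditions_combine:
  assumes \<alpha>: "\<alpha> \<in> Semi" and fin: "finite F" and F: "\<forall>(n, T)\<in>F. T \<in> \<alpha> n"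
  shows "\<exists>N. \<exists>S\<in>\<alpha> N. \<forall>\<gamma>\<in>Semi. S \<in> \<gamma> N \<longrightarrow> (\<forall>(n, T)\<in>F. T \<in> \<gamma> n)"
  using fin F
proof (induction F)
  case empty
  then show ?case using ultrafilters_top[OF Semi_ultrafilter[OF \<alpha>]] by auto
next
  case (insert p F)
  obtain n T where p: "p = (n, T)" by (cases p)
  obtain N S where NS: "S \<in> \<alpha> N" "\<forall>\<gamma>\<in>Semi. S \<in> \<gamma> N \<longrightarrow> (\<forall>(n, T)\<in>F. T \<in> \<gamma> n)"
    using insert.IH insert.prems by auto
  have T: "T \<in> \<alpha> n" using insert.prems p by simp
  have sub: "S \<subseteq> H N" "T \<subseteq> H n"
    using NS(1) T ultrafilters_sub[OF Semi_ultrafilter[OF \<alpha>]] by blast+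
  define M where "M = max N n"
  have M: "N \<le> M" "n \<le> M" by (simp_all add: M_def)
  let ?S = "{x \<in> H M. restrict x (U N) \<in> S}" and ?T = "{x \<in> H M. restrict x (U n) \<in> T}"
  have "?S \<inter> ?T \<in> \<alpha> M"
    using ultrafilters_inter[OF Semi_ultrafilter[OF \<alpha>]] NS(1) T
      Semi_restrict[OF \<alpha> M(1) sub(1)] Semi_restrict[OF \<alpha> M(2) sub(2)] by blast
  moreover have "S \<in> \<gamma> N \<and> T \<in> \<gamma> n" if \<gamma>: "\<gamma> \<in> Semi" and mem: "?S \<inter> ?T \<in> \<gamma> M" for \<gamma>
  proof -
    have "?S \<in> \<gamma> M" "?T \<in> \<gamma> M"
      by (rule ultrafilters_mono[OF Semi_ultrafilter[OF \<gamma>] mem]; blast)+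
    then show ?thesis
      using Semi_restrict[OF \<gamma> M(1) sub(1)] Semi_restrict[OF \<gamma> M(2) sub(2)] by blast
  qed
  ultimately show ?case
    using NS(2) p by (intro exI[of _ M] bexI[of _ "?S \<inter> ?T"]) auto
qed

text \<open>Reduce to one condition \<open>S \<in> \<alpha> N\<close>; then \<open>S\<close> is nonempty, and an automorphism extending one of its
  elements satisfies it.\<close>

lemma Aut_dense:
  assumes \<alpha>: "\<alpha> \<in> Semi" and fin: "finite F" and F: "\<forall>(n, T)\<in>F. T \<in> \<alpha> n"
  shows "\<exists>g\<in>Aut L K. \<forall>(n, T)\<in>F. restrict g (U n) \<in> T"
proof -
  obtain N S where S: "S \<in> \<alpha> N"
    and NS: "\<forall>\<gamma>\<in>Semi. S \<in> \<gamma> N \<longrightarrow> (\<forall>(n, T)\<in>F. T \<in> \<gamma> n)"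
    using finitely_many_conditions_combine[OF \<alpha> fin F] by blast
  have sub: "S \<subseteq> H N" using ultrafilters_sub[OF Semi_ultrafilter[OF \<alpha>] S] .
  have "S \<noteq> {}" using S ultrafilters_empty[OF Semi_ultrafilter[OF \<alpha>]] by metis
  then obtain x where x: "x \<in> S" by blast
  then obtain g where g: "g \<in> Aut L K" "restrict g (U N) = x" using extend_to_aut sub by blast
  have "S \<in> of_aut g N" using sub g x by (simp add: in_of_aut_iff)
  then have "\<forall>(n, T)\<in>F. T \<in> of_aut g n" using NS of_aut_in_Semi[OF g(1)] by blast
  then show ?thesis using g(1) by (auto simp: in_of_aut_iff)
qed

text \<open>By density, finitely many satisfiable conditions are already satisfied by an automorphism. So
  the sets of automorphisms satisfying single conditions have the finite intersection property, and
  an ultrafilter on \<open>G\<close> containing them all gives the required point.\<close>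

lemma Semi_compact:
  assumes sub: "\<forall>(n, T)\<in>\<F>. T \<subseteq> H n"
    and fin: "\<And>F. finite F \<Longrightarrow> F \<subseteq> \<F> \<Longrightarrow> \<exists>\<alpha>\<in>Semi. \<forall>(n, T)\<in>F. T \<in> \<alpha> n"
  shows "\<exists>\<alpha>\<in>Semi. \<forall>(n, T)\<in>\<F>. T \<in> \<alpha> n"
proof -
  define E where "E = (\<lambda>(n, T). {g \<in> Aut L K. restrict g (U n) \<in> T})"
  have "\<exists>W\<in>ultrafilters (Aut L K). E ` \<F> \<subseteq> W"
  proof (rule ultrafilter_extension)
    show "E ` \<F> \<subseteq> Pow (Aut L K)" by (auto simp: E_def)
  next
    fix G assume G: "finite G" "G \<subseteq> E ` \<F>"
    obtain F where F: "F \<subseteq> \<F>" "finite F" "G = E ` F"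
      using finite_subset_image[OF G] by blast
    obtain \<alpha> where \<alpha>: "\<alpha> \<in> Semi" "\<forall>(n, T)\<in>F. T \<in> \<alpha> n" using fin[OF F(2,1)] by blast
    obtain g where "g \<in> Aut L K" "\<forall>(n, T)\<in>F. restrict g (U n) \<in> T"
      using Aut_dense[OF \<alpha>(1) F(2) \<alpha>(2)] by blast
    then have "g \<in> Aut L K \<inter> \<Inter>G" by (auto simp: F(3) E_def)
    then show "Aut L K \<inter> \<Inter>G \<noteq> {}" by blast
  qed
  then obtain W where W: "W \<in> ultrafilters (Aut L K)" "E ` \<F> \<subseteq> W" by blast
  have "T \<in> beta_map (Aut L K) (H n) (\<lambda>g. restrict g (U n)) W" if "(n, T) \<in> \<F>" for n T
  proof -
    have "E (n, T) \<in> W" "T \<subseteq> H n" using W(2) sub that by auto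
    then show ?thesis by (simp add: beta_map_def E_def)
  qed
  then show ?thesis
    by (intro bexI[OF _ ultrafilter_on_Aut_gives_Semi[OF W(1)]]) auto
qed


section \<open>Orbit closures and syndetic sets\<close>

lemma shift_char_fn:
  assumes f: "f \<in> H m" "f ` U m \<subseteq> U n" and g: "g \<in> Aut L K"
  shows "shift L K (A m) (char_fn L K (A m) S) g f \<longleftrightarrow> compose (U m) (restrict g (U n)) f \<in> S"
proof -
  have eq: "compose (U m) (restrict g (U n)) f = compose (U m) g f"
    using f(2) by (auto simp: compose_def fun_eq_iff)
  have "compose (U m) g f \<in> H m"
    using compose_in_H[OF f restrict_aut_in_H[OF g]] by (simp add: eq)
  then show ?thesis using f(1) by (simp add: shift_def char_fn_def eq H_set_def)
qed

text \<open>For each \<open>f\<close>, agreement of a shift of \<open>\<chi>\<^sub>S\<close> with \<open>\<chi>\<^sub>T\<close> at \<open>f\<close> is a condition \<open>cond f\<close> on the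
  restriction of the automorphism to some \<open>A\<^sub>n\<close> containing the range of \<open>f\<close>. A point of \<open>S(G)\<close>
  satisfies all these conditions exactly if its preimage of \<open>S\<close> is \<open>T\<close>. Density of \<open>G\<close> and compactness
  of \<open>S(G)\<close> translate between such a point and automorphisms satisfying finitely many conditions.\<close>

lemma in_orbit_closure_char_fn_iff:
  assumes S: "S \<subseteq> H m" and T: "T \<subseteq> H m"
  shows "char_fn L K (A m) T \<in> orbit_closure L K (A m) (char_fn L K (A m) S) \<longleftrightarrow>
    (\<exists>\<alpha>\<in>Semi. T = preimage \<alpha> m S)"
proof -
  define level where "level f = (SOME n. m \<le> n \<and> f ` U m \<subseteq> U n)" for f
  have level: "m \<le> level f" "f ` U m \<subseteq> U (level f)" if "f \<in> H m" for f
    using someI_ex[of "\<lambda>n. m \<le> n \<and> f ` U m \<subseteq> U n"] H_level[OF that] unfolding level_def by blast+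
  define cond where "cond f = (level f, {x \<in> H (level f). compose (U m) x f \<in> S \<longleftrightarrow> f \<in> T})" for f
  have Emb: "Emb L (A m) K = H m" by (simp add: H_set_def)
  have approx: "char_fn L K (A m) T \<in> orbit_closure L K (A m) (char_fn L K (A m) S) \<longleftrightarrow>
    (\<forall>F. finite F \<and> F \<subseteq> H m \<longrightarrow> (\<exists>g\<in>Aut L K. \<forall>f\<in>F. restrict g (U (level f)) \<in> snd (cond f)))"
  proof -
    have eq: "shift L K (A m) (char_fn L K (A m) S) g f = char_fn L K (A m) T f \<longleftrightarrow>
        restrict g (U (level f)) \<in> snd (cond f)" if "f \<in> H m" "g \<in> Aut L K" for f g
      using shift_char_fn[OF that(1) level(2)[OF that(1)] that(2)] that restrict_aut_in_H[OF that(2)]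
      by (auto simp: cond_def char_fn_def Emb)
    have ext: "char_fn L K (A m) T \<in> extensional (Emb L (A m) K)" by (simp add: char_fn_def)
    show ?thesis
      unfolding in_orbit_closure_iff[OF ext] Emb
      by (intro iff_allI imp_cong refl bex_cong ball_cong eq) auto
  qed
  have cond_iff: "snd (cond f) \<in> \<alpha> (level f) \<longleftrightarrow> (f \<in> preimage \<alpha> m S \<longleftrightarrow> f \<in> T)"
    if \<alpha>: "\<alpha> \<in> Semi" and f: "f \<in> H m" for \<alpha> f
  proof -
    let ?X = "{x \<in> H (level f). compose (U m) x f \<in> S}"
    have "snd (cond f) = (if f \<in> T then ?X else H (level f) - ?X)" by (auto simp: cond_def)
    then show ?thesis
      using preimage_level[OF \<alpha> level(1)[OF f] f level(2)[OF f] S]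
        ultrafilters_compl[OF Semi_ultrafilter[OF \<alpha>], of ?X] by auto
  qed
  show ?thesis
  proof
    assume L: "char_fn L K (A m) T \<in> orbit_closure L K (A m) (char_fn L K (A m) S)"
    have "\<exists>\<alpha>\<in>Semi. \<forall>(n, X)\<in>cond ` H m. X \<in> \<alpha> n"
    proof (rule Semi_compact)
      show "\<forall>(n, X)\<in>cond ` H m. X \<subseteq> H n" by (auto simp: cond_def)
    next
      fix F assume F: "finite F" "F \<subseteq> cond ` H m"
      obtain F' where F': "F' \<subseteq> H m" "finite F'" "F = cond ` F'"
        using finite_subset_image[OF F] by blast
      then obtain g where g: "g \<in> Aut L K" "\<forall>f\<in>F'. restrict g (U (level f)) \<in> snd (cond f)"
        using L unfolding approx by blast
      then show "\<exists>\<alpha>\<in>Semi. \<forall>(n, X)\<in>F. X \<in> \<alpha> n"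
        by (intro bexI[OF _ of_aut_in_Semi[OF g(1)]]) (auto simp: F'(3) in_of_aut_iff cond_def)
    qed
    then obtain \<alpha> where \<alpha>: "\<alpha> \<in> Semi" and mem: "\<forall>(n, X)\<in>cond ` H m. X \<in> \<alpha> n" by blast
    have "f \<in> preimage \<alpha> m S \<longleftrightarrow> f \<in> T" if f: "f \<in> H m" for f
      using mem f cond_iff[OF \<alpha> f] by (auto simp: cond_def)
    then show "\<exists>\<alpha>\<in>Semi. T = preimage \<alpha> m S"
      using \<alpha> T preimage_subset by blast
  next
    assume "\<exists>\<alpha>\<in>Semi. T = preimage \<alpha> m S"
    then obtain \<alpha> where \<alpha>: "\<alpha> \<in> Semi" and eq: "T = preimage \<alpha> m S" by blast
    show "char_fn L K (A m) T \<in> orbit_closure L K (A m) (char_fn L K (A m) S)"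
      unfolding approx
    proof (intro allI impI, elim conjE)
      fix F assume F: "finite F" "F \<subseteq> H m"
      have "snd (cond f) \<in> \<alpha> (level f)" if "f \<in> F" for f
        using cond_iff[OF \<alpha>, of f] F(2) that eq by blast
      then have "\<forall>(n, X)\<in>cond ` F. X \<in> \<alpha> n" by (auto simp: cond_def)
      then obtain g where "g \<in> Aut L K" "\<forall>(n, X)\<in>cond ` F. restrict g (U n) \<in> X"
        using Aut_dense[OF \<alpha> finite_imageI[OF F(1)]] by blast
      then show "\<exists>g\<in>Aut L K. \<forall>f\<in>F. restrict g (U (level f)) \<in> snd (cond f)"
        by (intro bexI[of _ g]) (auto simp: cond_def)
    qed
  qed
qed

lemma syndetic_iff:
  assumes "S \<subseteq> H m"
  shows "syndetic L K (A m) S \<longleftrightarrow> (\<forall>\<alpha>\<in>Semi. preimage \<alpha> m S \<noteq> {})"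
  using in_orbit_closure_char_fn_iff[OF assms empty_subsetI] assms
  unfolding syndetic_def by (auto simp: H_set_def)

lemma piecewise_syndetic_iff:
  assumes P: "P \<subseteq> H m"
  shows "piecewise_syndetic L K (A m) P \<longleftrightarrow>
    (\<exists>\<alpha>\<in>Semi. \<forall>\<gamma>\<in>Semi. preimage (\<alpha> \<odot> \<gamma>) m P \<noteq> {})"
proof -
  have "piecewise_syndetic L K (A m) P \<longleftrightarrow> (\<exists>S. S \<subseteq> H m \<and> syndetic L K (A m) S \<and>
      char_fn L K (A m) S \<in> orbit_closure L K (A m) (char_fn L K (A m) P))"
    using P by (auto simp: piecewise_syndetic_def syndetic_def H_set_def)
  also have "\<dots> \<longleftrightarrow> (\<exists>S. S \<subseteq> H m \<and> syndetic L K (A m) S \<and> (\<exists>\<alpha>\<in>Semi. S = preimage \<alpha> m P))"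
    by (simp add: in_orbit_closure_char_fn_iff[OF P] cong: conj_cong)
  also have "\<dots> \<longleftrightarrow> (\<exists>\<alpha>\<in>Semi. syndetic L K (A m) (preimage \<alpha> m P))"
    using preimage_subset[of _ m P] by (intro iffI; elim exE conjE bexE) auto
  finally show ?thesis
    using P by (simp add: syndetic_iff[OF preimage_subset] preimage_mult cong: ball_cong bex_cong)
qed


section \<open>Minimal right ideals\<close>

abbreviation principal_ideal where "principal_ideal \<alpha> \<equiv> (\<lambda>\<gamma>. \<alpha> \<odot> \<gamma>) ` Semi"

lemma principal_ideal_right_ideal:
  assumes \<alpha>: "\<alpha> \<in> Semi"
  shows "right_ideal L K A (principal_ideal \<alpha>)"
proof -
  obtain g where "g \<in> Aut L K" using extend_to_aut incl_in_H by blast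
  then have "Semi \<noteq> {}" using of_aut_in_Semi by blast
  then show ?thesis
    unfolding right_ideal_def using mult_in_Semi[OF \<alpha>] mult_in_Semi mult_assoc[OF \<alpha>] by auto
qed

lemma principal_ideal_subset:
  "right_ideal L K A R \<Longrightarrow> \<alpha> \<in> R \<Longrightarrow> principal_ideal \<alpha> \<subseteq> R"
  by (auto simp: right_ideal_def)

text \<open>All conditions that hold throughout \<open>\<alpha> S(G)\<close>. They determine the closure of that ideal, which is
  the ideal itself by the next lemma; inclusion of ideals thus becomes reverse inclusion of families
  of conditions, to which Zorn's lemma for set inclusion applies.\<close>

definition ideal_conditions where
  "ideal_conditions \<alpha> = {(n, T). \<forall>\<gamma>\<in>Semi. T \<in> (\<alpha> \<odot> \<gamma>) n}"

text \<open>Solving \<open>\<beta> = \<alpha>\<gamma>\<close> for \<open>\<gamma>\<close> amounts to the conditions \<open>\<alpha>\<inverse>T \<in> \<gamma> n\<close> for \<open>T \<in> \<beta> n\<close>. Any single one of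
  them is satisfiable: otherwise the complement of \<open>T\<close> would be a condition holding throughout
  \<open>\<alpha> S(G)\<close>, hence at \<open>\<beta>\<close>. Finitely many reduce to a single one, and compactness does the rest.\<close>

lemma principal_ideal_closed:
  assumes \<alpha>: "\<alpha> \<in> Semi" and \<beta>: "\<beta> \<in> Semi"
    and cl: "\<forall>(n, T)\<in>ideal_conditions \<alpha>. T \<in> \<beta> n"
  shows "\<beta> \<in> principal_ideal \<alpha>"
proof -
  have meets: "\<exists>\<gamma>\<in>Semi. T \<in> (\<alpha> \<odot> \<gamma>) n" if T: "T \<in> \<beta> n" for n T
  proof (rule ccontr)
    assume "\<not> ?thesis"
    moreover have TH: "T \<subseteq> H n" using ultrafilters_sub[OF Semi_ultrafilter[OF \<beta>] T] .
    ultimately have "H n - T \<in> (\<alpha> \<odot> \<gamma>) n" if "\<gamma> \<in> Semi" for \<gamma>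
      using ultrafilters_compl[OF Semi_ultrafilter[OF mult_in_Semi[OF \<alpha> that]] TH] that by blast
    then have "(n, H n - T) \<in> ideal_conditions \<alpha>" by (simp add: ideal_conditions_def)
    then have "H n - T \<in> \<beta> n" using cl by blast
    then show False using ultrafilters_compl[OF Semi_ultrafilter[OF \<beta>] TH] T by blast
  qed
  let ?pre = "\<lambda>(n, T). (n, preimage \<alpha> n T)"
  have "\<exists>\<gamma>\<in>Semi. \<forall>(n, T)\<in>?pre ` {(n, T). T \<in> \<beta> n}. T \<in> \<gamma> n"
  proof (rule Semi_compact)
    show "\<forall>(n, T)\<in>?pre ` {(n, T). T \<in> \<beta> n}. T \<subseteq> H n" by (auto simp: preimage_def)
  next
    fix F assume F: "finite F" "F \<subseteq> ?pre ` {(n, T). T \<in> \<beta> n}"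
    obtain F' where F': "F' \<subseteq> {(n, T). T \<in> \<beta> n}" "finite F'" "F = ?pre ` F'"
      using finite_subset_image[OF F] by blast
    then have "\<forall>(n, T)\<in>F'. T \<in> \<beta> n" by blast
    then obtain N S where "S \<in> \<beta> N"
      and S: "\<forall>\<delta>\<in>Semi. S \<in> \<delta> N \<longrightarrow> (\<forall>(n, T)\<in>F'. T \<in> \<delta> n)"
      using finitely_many_conditions_combine[OF \<beta> F'(2)] by blast
    then obtain \<gamma> where \<gamma>: "\<gamma> \<in> Semi" "S \<in> (\<alpha> \<odot> \<gamma>) N" using meets by blast
    have "\<forall>(n, T)\<in>F'. T \<in> (\<alpha> \<odot> \<gamma>) n" using S mult_in_Semi[OF \<alpha> \<gamma>(1)] \<gamma>(2) by blast
    then show "\<exists>\<gamma>\<in>Semi. \<forall>(n, T)\<in>F. T \<in> \<gamma> n"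
      using \<gamma>(1) by (intro bexI[of _ \<gamma>]) (auto simp: F'(3) in_mult_iff)
  qed
  then obtain \<gamma> where \<gamma>: "\<gamma> \<in> Semi"
    and mem: "\<And>n T. T \<in> \<beta> n \<Longrightarrow> preimage \<alpha> n T \<in> \<gamma> n"
    by auto
  have "\<beta> = \<alpha> \<odot> \<gamma>"
  proof (rule Semi_eqI[OF \<beta> mult_in_Semi[OF \<alpha> \<gamma>]])
    fix n T assume "T \<in> \<beta> n"
    then show "T \<in> (\<alpha> \<odot> \<gamma>) n"
      using mem ultrafilters_sub[OF Semi_ultrafilter[OF \<beta>]] by (simp add: in_mult_iff)
  qed
  then show ?thesis using \<gamma> by blast
qed

lemma principal_ideal_subset_iff:
  assumes \<alpha>: "\<alpha> \<in> Semi" and \<beta>: "\<beta> \<in> Semi"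
  shows "principal_ideal \<beta> \<subseteq> principal_ideal \<alpha> \<longleftrightarrow> ideal_conditions \<alpha> \<subseteq> ideal_conditions \<beta>"
proof
  assume sub: "principal_ideal \<beta> \<subseteq> principal_ideal \<alpha>"
  have "T \<in> (\<beta> \<odot> \<gamma>) n" if T: "(n, T) \<in> ideal_conditions \<alpha>" and \<gamma>: "\<gamma> \<in> Semi" for n T \<gamma>
  proof -
    obtain \<delta> where "\<delta> \<in> Semi" "\<beta> \<odot> \<gamma> = \<alpha> \<odot> \<delta>" using sub \<gamma> by blast
    then show ?thesis using T by (simp add: ideal_conditions_def)
  qed
  then show "ideal_conditions \<alpha> \<subseteq> ideal_conditions \<beta>"
    by (auto simp: ideal_conditions_def[of \<beta>])
next
  assume sub: "ideal_conditions \<alpha> \<subseteq> ideal_conditions \<beta>"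
  show "principal_ideal \<beta> \<subseteq> principal_ideal \<alpha>"
  proof (rule image_subsetI)
    fix \<gamma> assume \<gamma>: "\<gamma> \<in> Semi"
    have "\<forall>(n, T)\<in>ideal_conditions \<beta>. T \<in> (\<beta> \<odot> \<gamma>) n"
      using \<gamma> by (auto simp: ideal_conditions_def)
    then have "\<forall>(n, T)\<in>ideal_conditions \<alpha>. T \<in> (\<beta> \<odot> \<gamma>) n" using sub by blast
    then show "\<beta> \<odot> \<gamma> \<in> principal_ideal \<alpha>"
      by (rule principal_ideal_closed[OF \<alpha> mult_in_Semi[OF \<beta> \<gamma>]])
  qed
qed

lemma ideal_conditions_satisfiable:
  assumes \<alpha>: "\<alpha> \<in> Semi"
  shows "\<exists>\<beta>\<in>Semi. \<forall>(n, T)\<in>ideal_conditions \<alpha>. T \<in> \<beta> n"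
proof -
  have "principal_ideal \<alpha> \<noteq> {}"
    using principal_ideal_right_ideal[OF \<alpha>] by (simp add: right_ideal_def)
  then obtain \<gamma> where \<gamma>: "\<gamma> \<in> Semi" by blast
  then have "\<forall>(n, T)\<in>ideal_conditions \<alpha>. T \<in> (\<alpha> \<odot> \<gamma>) n" by (auto simp: ideal_conditions_def)
  then show ?thesis using mult_in_Semi[OF \<alpha> \<gamma>] by blast
qed

lemma ideal_conditions_subset:
  assumes \<alpha>: "\<alpha> \<in> Semi" and T: "(n, T) \<in> ideal_conditions \<alpha>"
  shows "T \<subseteq> H n"
proof -
  obtain \<beta> where "\<beta> \<in> Semi" "T \<in> \<beta> n" using ideal_conditions_satisfiable[OF \<alpha>] T by blast
  then show ?thesis using ultrafilters_sub[OF Semi_ultrafilter] by blast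
qed

text \<open>A chain of principal ideals has a common point: a finite set of the conditions involved comes
  from a single ideal, so compactness gives a point satisfying all of them, and by closedness it lies
  in each ideal.\<close>

lemma principal_ideals_chain_bound:
  assumes R: "R \<subseteq> Semi" and chain: "subset.chain (ideal_conditions ` R) \<C>" and ne: "\<C> \<noteq> {}"
  shows "\<exists>\<beta>\<in>Semi. \<forall>\<alpha>\<in>R. ideal_conditions \<alpha> \<in> \<C> \<longrightarrow> \<beta> \<in> principal_ideal \<alpha>"
proof -
  have \<C>: "\<exists>\<alpha>\<in>Semi. X = ideal_conditions \<alpha>" if "X \<in> \<C>" for X
  proof -
    have "X \<in> ideal_conditions ` R" using chain that by (auto simp: subset.chain_def)
    then show ?thesis using R by blast
  qed
  have "\<exists>\<beta>\<in>Semi. \<forall>(n, T)\<in>\<Union>\<C>. T \<in> \<beta> n"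
  proof (rule Semi_compact)
    show "\<forall>(n, T)\<in>\<Union>\<C>. T \<subseteq> H n"
    proof (intro ballI, clarify)
      fix n T X f assume "(n, T) \<in> X" "X \<in> \<C>" "f \<in> T"
      then show "f \<in> H n" using \<C>[of X] ideal_conditions_subset by blast
    qed
  next
    fix F assume F: "finite F" "F \<subseteq> \<Union>\<C>"
    obtain X where X: "X \<in> \<C>" "F \<subseteq> X" using finite_subset_Union_chain[OF F ne chain] .
    obtain \<alpha> where \<alpha>: "\<alpha> \<in> Semi" "X = ideal_conditions \<alpha>" using \<C>[OF X(1)] by blast
    show "\<exists>\<beta>\<in>Semi. \<forall>(n, T)\<in>F. T \<in> \<beta> n"
      using ideal_conditions_satisfiable[OF \<alpha>(1)] X(2) unfolding \<alpha>(2) by blast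
  qed
  then obtain \<beta> where \<beta>: "\<beta> \<in> Semi" and mem: "\<forall>(n, T)\<in>\<Union>\<C>. T \<in> \<beta> n" by blast
  have "\<beta> \<in> principal_ideal \<alpha>" if \<alpha>: "\<alpha> \<in> R" "ideal_conditions \<alpha> \<in> \<C>" for \<alpha>
  proof (rule principal_ideal_closed[OF _ \<beta>])
    show "\<alpha> \<in> Semi" using R \<alpha>(1) by (rule subsetD)
    show "\<forall>(n, T)\<in>ideal_conditions \<alpha>. T \<in> \<beta> n" using mem \<alpha>(2) by blast
  qed
  then show ?thesis using \<beta> by blast
qed

text \<open>Every right ideal contains \<open>\<alpha> S(G)\<close> for each of its elements \<open>\<alpha>\<close>, so a minimal one among the
  ideals \<open>\<alpha> S(G)\<close> with \<open>\<alpha> \<in> R\<close> is a minimal right ideal.\<close>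

lemma right_ideal_contains_minimal:
  assumes R: "right_ideal L K A R"
  shows "\<exists>Y\<subseteq>R. minimal_right_ideal L K A Y"
proof -
  have RS: "R \<subseteq> Semi" and Rne: "R \<noteq> {}" using R by (auto simp: right_ideal_def)
  have "\<exists>M\<in>ideal_conditions ` R. \<forall>X\<in>ideal_conditions ` R. M \<subseteq> X \<longrightarrow> X = M"
  proof (rule subset_Zorn)
    fix \<C> assume chain: "subset.chain (ideal_conditions ` R) \<C>"
    show "\<exists>M\<in>ideal_conditions ` R. \<forall>X\<in>\<C>. X \<subseteq> M"
    proof (cases "\<C> = {}")
      case True
      then show ?thesis using Rne by blast
    next
      case False
      obtain \<beta> where \<beta>: "\<beta> \<in> Semi"
        and below: "\<And>\<alpha>. \<alpha> \<in> R \<Longrightarrow> ideal_conditions \<alpha> \<in> \<C> \<Longrightarrow> \<beta> \<in> principal_ideal \<alpha>"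
        using principal_ideals_chain_bound[OF RS chain False] by blast
      have bound: "X \<subseteq> ideal_conditions \<beta> \<and> \<beta> \<in> R" if X: "X \<in> \<C>" for X
      proof -
        obtain \<alpha> where \<alpha>: "\<alpha> \<in> R" "X = ideal_conditions \<alpha>"
          using chain X by (auto simp: subset.chain_def)
        have \<alpha>S: "\<alpha> \<in> Semi" using RS \<alpha>(1) by (rule subsetD)
        have \<beta>\<alpha>: "\<beta> \<in> principal_ideal \<alpha>" using below \<alpha> X by simp
        have "principal_ideal \<beta> \<subseteq> principal_ideal \<alpha>"
          by (rule principal_ideal_subset[OF principal_ideal_right_ideal[OF \<alpha>S] \<beta>\<alpha>])
        moreover have "\<beta> \<in> R" using principal_ideal_subset[OF R \<alpha>(1)] \<beta>\<alpha> by (rule subsetD)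
        ultimately show ?thesis
          unfolding \<alpha>(2) principal_ideal_subset_iff[OF \<alpha>S \<beta>] by blast
      qed
      obtain X where "X \<in> \<C>" using False by blast
      then have "\<beta> \<in> R" using bound by blast
      then show ?thesis using bound by blast
    qed
  qed
  then obtain \<alpha> where \<alpha>: "\<alpha> \<in> R"
    and max: "\<And>\<beta>. \<beta> \<in> R \<Longrightarrow> ideal_conditions \<alpha> \<subseteq> ideal_conditions \<beta> \<Longrightarrow>
      ideal_conditions \<beta> = ideal_conditions \<alpha>"
    by blast
  have \<alpha>S: "\<alpha> \<in> Semi" using RS \<alpha> by (rule subsetD)
  have sub: "principal_ideal \<alpha> \<subseteq> R" using principal_ideal_subset[OF R \<alpha>] .
  have "R' = principal_ideal \<alpha>" if R': "right_ideal L K A R'" "R' \<subseteq> principal_ideal \<alpha>" for R'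
  proof -
    obtain \<beta> where \<beta>: "\<beta> \<in> R'" using R'(1) by (auto simp: right_ideal_def)
    have \<beta>R: "\<beta> \<in> R" using R'(2) sub \<beta> by (blast intro: subsetD)
    have \<beta>S: "\<beta> \<in> Semi" using RS \<beta>R by (rule subsetD)
    have \<beta>R': "principal_ideal \<beta> \<subseteq> R'" using principal_ideal_subset[OF R'(1) \<beta>] .
    then have "principal_ideal \<beta> \<subseteq> principal_ideal \<alpha>" using R'(2) by (rule subset_trans)
    then have "ideal_conditions \<beta> = ideal_conditions \<alpha>"
      unfolding principal_ideal_subset_iff[OF \<alpha>S \<beta>S] by (rule max[OF \<beta>R])
    then have "principal_ideal \<alpha> \<subseteq> principal_ideal \<beta>"
      by (simp add: principal_ideal_subset_iff[OF \<beta>S \<alpha>S])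
    then have "principal_ideal \<alpha> \<subseteq> R'" using \<beta>R' by (rule subset_trans)
    then show ?thesis by (rule subset_antisym[OF R'(2)])
  qed
  then have "minimal_right_ideal L K A (principal_ideal \<alpha>)"
    using principal_ideal_right_ideal[OF \<alpha>S] by (simp add: minimal_right_ideal_def)
  then show ?thesis using sub by blast
qed

lemma piecewise_syndetic_iff_minimal_right_ideal:
  assumes P: "P \<subseteq> H m"
  shows "piecewise_syndetic L K (A m) P \<longleftrightarrow>
    (\<exists>Y. minimal_right_ideal L K A Y \<and> (\<exists>\<alpha>\<in>Y. P \<in> \<alpha> m))"
proof
  assume "piecewise_syndetic L K (A m) P"
  then obtain \<alpha> where \<alpha>: "\<alpha> \<in> Semi" and ne: "\<And>\<gamma>. \<gamma> \<in> Semi \<Longrightarrow> preimage (\<alpha> \<odot> \<gamma>) m P \<noteq> {}"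
    unfolding piecewise_syndetic_iff[OF P] by blast
  obtain Y where Y: "minimal_right_ideal L K A Y" "Y \<subseteq> principal_ideal \<alpha>"
    using right_ideal_contains_minimal[OF principal_ideal_right_ideal[OF \<alpha>]] by blast
  have ideal: "right_ideal L K A Y" using Y(1) by (simp add: minimal_right_ideal_def)
  then obtain \<beta> where \<beta>: "\<beta> \<in> Y" by (auto simp: right_ideal_def)
  then obtain f where f: "f \<in> preimage \<beta> m P" using Y(2) ne by fast
  then obtain g where g: "g \<in> Aut L K" "restrict g (U m) = f"
    using extend_to_aut preimage_subset by blast
  have "preimage \<beta> m P \<in> of_aut g m" using f g(2) preimage_subset by (simp add: in_of_aut_iff)
  then have "P \<in> (\<beta> \<odot> of_aut g) m" using P by (simp add: in_mult_iff)
  moreover have "\<beta> \<odot> of_aut g \<in> Y"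
    using ideal \<beta> of_aut_in_Semi[OF g(1)] by (simp add: right_ideal_def)
  ultimately show "\<exists>Y. minimal_right_ideal L K A Y \<and> (\<exists>\<alpha>\<in>Y. P \<in> \<alpha> m)" using Y(1) by blast
next
  assume "\<exists>Y. minimal_right_ideal L K A Y \<and> (\<exists>\<alpha>\<in>Y. P \<in> \<alpha> m)"
  then obtain Y \<alpha> where Y: "minimal_right_ideal L K A Y" and \<alpha>Y: "\<alpha> \<in> Y" and P\<alpha>: "P \<in> \<alpha> m"
    by blast
  have ideal: "right_ideal L K A Y" using Y by (simp add: minimal_right_ideal_def)
  then have YS: "Y \<subseteq> Semi" and closed: "\<And>\<gamma>. \<gamma> \<in> Semi \<Longrightarrow> \<alpha> \<odot> \<gamma> \<in> Y"
    using \<alpha>Y by (auto simp: right_ideal_def)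
  have "preimage (\<alpha> \<odot> \<gamma>) m P \<noteq> {}" if \<gamma>: "\<gamma> \<in> Semi" for \<gamma>
  proof
    assume empty: "preimage (\<alpha> \<odot> \<gamma>) m P = {}"
    have \<beta>: "\<alpha> \<odot> \<gamma> \<in> Semi" using closed[OF \<gamma>] YS by blast
    have "principal_ideal (\<alpha> \<odot> \<gamma>) = Y"
      using Y principal_ideal_right_ideal[OF \<beta>] principal_ideal_subset[OF ideal closed[OF \<gamma>]]
      by (simp add: minimal_right_ideal_def)
    then obtain \<delta> where \<delta>: "\<delta> \<in> Semi" "\<alpha> = \<alpha> \<odot> \<gamma> \<odot> \<delta>" using \<alpha>Y by blast
    have "preimage \<alpha> m P = {}"
      using preimage_mult[OF \<beta> \<delta>(1) P] preimage_empty[OF \<delta>(1)] \<delta>(2) empty by simp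
    then show False using incl_in_preimage_iff[OF _ P] \<alpha>Y YS P\<alpha> by blast
  qed
  then show "piecewise_syndetic L K (A m) P"
    unfolding piecewise_syndetic_iff[OF P] using \<alpha>Y YS by blast
qed

end

theorem proposition4p7:
  fixes L :: "'r language" and K :: "('r, 'a) rel_struct"
    and A :: "nat \<Rightarrow> ('r, 'a) rel_struct" and m :: nat and P :: "('a \<Rightarrow> 'a) set"
  assumes "fraisse_structure L K"
    and "exhaustion L K A"
    and "P \<subseteq> H_set L K A m"
  shows "(piecewise_syndetic L K (A m) P \<longleftrightarrow>
            (\<exists>Y. minimal_right_ideal L K A Y \<and> (\<exists>\<alpha>\<in>Y. P \<in> \<alpha> m))) \<and>
         (piecewise_syndetic L K (A m) P \<longleftrightarrow>
            (\<exists>Y. minimal_right_ideal L K A Y \<and> tilde_set L K A m P \<inter> Y \<noteq> {}))"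
proof -
  interpret exhausted_fraisse_structure L K A by standard (fact assms)+
  have "tilde_set L K A m P \<inter> Y \<noteq> {} \<longleftrightarrow> (\<exists>\<alpha>\<in>Y. P \<in> \<alpha> m)"
    if "minimal_right_ideal L K A Y" for Y
    using that by (auto simp: tilde_set_def minimal_right_ideal_def right_ideal_def)
  then have "(\<exists>Y. minimal_right_ideal L K A Y \<and> tilde_set L K A m P \<inter> Y \<noteq> {}) \<longleftrightarrow>
      (\<exists>Y. minimal_right_ideal L K A Y \<and> (\<exists>\<alpha>\<in>Y. P \<in> \<alpha> m))"
    by (intro ex_cong1 conj_cong refl)
  with piecewise_syndetic_iff_minimal_right_ideal[OF assms(3)] show ?thesis by (simp only: simp_thms)
qed

end
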